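(* Let $k$ be a fixed constant. There is a randomized algorithm that, on input $\varepsilon>0$, $\delta>0$ and probability vectors $\langle p_1,\dots,p_n\rangle$ (arbitrary) and $\langle q_1,\dots,q_n\rangle$ whose entries take at most $k$ distinct values, runs in time polynomial in the input size, $1/\varepsilon$ and $1/\delta$, and outputs a number $v$ such that $(1-\varepsilon)\,d_{\mathrm{TV}}(P,Q)\le v\le(1+\varepsilon)\,d_{\mathrm{TV}}(P,Q)$ with probability at least $1-\delta$, where $P=\bigotimes_{i=1}^n\mathrm{Bern}(p_i)$ and $Q=\bigotimes_{i=1}^n\mathrm{Bern}(q_i)$.
   Context: For distributions $P,Q$ on a finite set $\mathcal{D}$, $d_{\mathrm{TV}}(P,Q)=\frac12\sum_{x\in\mathcal{D}}|P(x)-Q(x)|$. $\mathrm{Bern}(p)$ is the Bernoulli distribution with probability $p$ of $1$, and $\bigotimes_i\mathrm{Bern}(p_i)$ assigns to $x\in\{0,1\}^n$ probability $\prod_{i:x_i=1}p_i\prod_{i:x_i=0}(1-p_i)$. The parameters are rationals given in binary with bit-length polynomial in $n$. *)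

theory Defs
  imports "HOL-Probability.Probability" "HOL-Library.Log_Nat"
begin

text \<open>
  Model of computation: structured programs for a random access machine with integer cells,
  the logarithmic cost criterion and fair coin tosses.  Memory consists of integer-indexed
  arrays named by natural numbers; a program mentions finitely many names.  Every operation is
  charged the bit lengths of its operands, so that running times agree with those of
  probabilistic Turing machines up to a polynomial, in spite of the built-in multiplication
  and division.
\<close>

datatype binop = Add | Sub | Mul | Div | Less

datatype expr = Const int | Read nat expr | Op binop expr expr

text \<open>\<open>Toss x\<close> stores a fair random bit in cell 0 of array \<open>x\<close>.\<close>

datatype com =
    Skip
  | Write nat expr expr
  | Toss nat
  | Seq com com
  | Cond expr com com
  | While expr com

type_synonym store = "nat \<Rightarrow> int \<Rightarrow> int"

text \<open>One of the bits is for the sign; in particular the length is always positive.\<close>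

definition bit_length :: "int \<Rightarrow> nat" where
  "bit_length z = Suc (floorlog 2 (nat \<bar>z\<bar>))"

fun opval :: "binop \<Rightarrow> int \<Rightarrow> int \<Rightarrow> int" where
  "opval Add a b = a + b"
| "opval Sub a b = a - b"
| "opval Mul a b = a * b"
| "opval Div a b = a div b"
| "opval Less a b = (if a < b then 1 else 0)"

fun eval_expr :: "store \<Rightarrow> expr \<Rightarrow> int" where
  "eval_expr s (Const z) = z"
| "eval_expr s (Read x i) = s x (eval_expr s i)"
| "eval_expr s (Op f a b) = opval f (eval_expr s a) (eval_expr s b)"

fun cost_expr :: "store \<Rightarrow> expr \<Rightarrow> nat" where
  "cost_expr s (Const z) = bit_length z"
| "cost_expr s (Read x i) =
     cost_expr s i + bit_length (eval_expr s i) + bit_length (eval_expr s (Read x i))"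
| "cost_expr s (Op f a b) =
     cost_expr s a + cost_expr s b + bit_length (eval_expr s a) + bit_length (eval_expr s b)"

definition put :: "store \<Rightarrow> nat \<Rightarrow> int \<Rightarrow> int \<Rightarrow> store" where
  "put s x i z = s(x := (s x)(i := z))"

definition add_cost :: "nat \<Rightarrow> (store \<times> nat) pmf \<Rightarrow> (store \<times> nat) pmf" where
  "add_cost t = map_pmf (\<lambda>(s, u). (s, t + u))"

text \<open>
  \<open>exec c s D\<close>: started in \<open>s\<close>, the program \<open>c\<close> terminates for all outcomes of its coin tosses,
  and \<open>D\<close> is the joint distribution of the final store and the cost.  In the composite rules,
  \<open>K s'\<close> is the result distribution of the rest of the computation from the intermediate store
  \<open>s'\<close>; only its values on stores that are actually reached matter.
\<close>

inductive exec :: "com \<Rightarrow> store \<Rightarrow> (store \<times> nat) pmf \<Rightarrow> bool" where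
  Skip: "exec Skip s (return_pmf (s, 1))"
| Write: "exec (Write x i e) s
    (return_pmf (put s x (eval_expr s i) (eval_expr s e),
       cost_expr s i + cost_expr s e + bit_length (eval_expr s i) + bit_length (eval_expr s e)))"
| Toss: "exec (Toss x) s
    (map_pmf (\<lambda>b. (put s x 0 (of_bool b), 1)) (bernoulli_pmf (1/2)))"
| Seq: "exec c s D \<Longrightarrow> \<forall>(s', t) \<in> set_pmf D. exec c' s' (K s') \<Longrightarrow>
    exec (Seq c c') s (bind_pmf D (\<lambda>(s', t). add_cost t (K s')))"
| CondTrue: "eval_expr s e \<noteq> 0 \<Longrightarrow> exec c s D \<Longrightarrow>
    exec (Cond e c c') s (add_cost (cost_expr s e) D)"
| CondFalse: "eval_expr s e = 0 \<Longrightarrow> exec c' s D \<Longrightarrow>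
    exec (Cond e c c') s (add_cost (cost_expr s e) D)"
| WhileFalse: "eval_expr s e = 0 \<Longrightarrow>
    exec (While e c) s (return_pmf (s, cost_expr s e))"
| WhileTrue: "eval_expr s e \<noteq> 0 \<Longrightarrow> exec c s D \<Longrightarrow>
    \<forall>(s', t) \<in> set_pmf D. exec (While e c) s' (K s') \<Longrightarrow>
    exec (While e c) s
      (add_cost (cost_expr s e) (bind_pmf D (\<lambda>(s', t). add_cost t (K s'))))"

inductive_cases exec_SkipE: "exec Skip s D"
inductive_cases exec_WriteE: "exec (Write x i e) s D"
inductive_cases exec_TossE: "exec (Toss x) s D"
inductive_cases exec_SeqE: "exec (Seq c c') s D"
inductive_cases exec_CondE: "exec (Cond e c c') s D"
inductive_cases exec_WhileE: "exec (While e c) s D"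

lemma bind_cost_cong:
  assumes "\<And>s t. (s, t) \<in> set_pmf D \<Longrightarrow> K s = L s"
  shows "bind_pmf D (\<lambda>(s, t). add_cost t (K s)) = bind_pmf D (\<lambda>(s, t). add_cost t (L s))"
proof (rule bind_pmf_cong[OF refl])
  fix x assume "x \<in> set_pmf D"
  then show "(case x of (s, t) \<Rightarrow> add_cost t (K s)) = (case x of (s, t) \<Rightarrow> add_cost t (L s))"
    using assms by (cases x) simp
qed

lemma exec_unique: "exec c s D \<Longrightarrow> exec c s D' \<Longrightarrow> D = D'"
proof (induction arbitrary: D' rule: exec.induct)
  case (Skip s)
  from Skip.prems show ?case by (rule exec_SkipE) simp
next
  case (Write x i e s)
  from Write.prems show ?case by (rule exec_WriteE) simp
next
  case (Toss x s)
  from Toss.prems show ?case by (rule exec_TossE) simp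
next
  case (Seq c s D c' K)
  from Seq.prems show ?case
  proof (rule exec_SeqE)
    fix E L
    assume D': "D' = bind_pmf E (\<lambda>(s', t). add_cost t (L s'))"
      and E: "exec c s E" and L: "\<forall>(s', t) \<in> set_pmf E. exec c' s' (L s')"
    have DE: "D = E" by (rule Seq.IH(1)[OF E])
    have KL: "K s' = L s'" if "(s', t) \<in> set_pmf D" for s' t
      using bspec[OF Seq.IH(2) that] bspec[OF L that[unfolded DE]] unfolding prod.case by blast
    show ?case unfolding D' DE[symmetric] using KL by (rule bind_cost_cong)
  qed
next
  case (CondTrue s e c D c')
  from CondTrue.prems show ?case
    by (rule exec_CondE) (use CondTrue.hyps CondTrue.IH in blast)+
next
  case (CondFalse s e c' D c)
  from CondFalse.prems show ?case
    by (rule exec_CondE) (use CondFalse.hyps CondFalse.IH in blast)+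
next
  case (WhileFalse s e c)
  from WhileFalse.prems show ?case
    by (rule exec_WhileE) (use WhileFalse.hyps in simp_all)
next
  case (WhileTrue s e c D K)
  from WhileTrue.prems show ?case
  proof (rule exec_WhileE)
    assume "eval_expr s e = 0"
    with WhileTrue.hyps show ?case by simp
  next
    fix E L
    assume D': "D' = add_cost (cost_expr s e) (bind_pmf E (\<lambda>(s', t). add_cost t (L s')))"
      and E: "exec c s E" and L: "\<forall>(s', t) \<in> set_pmf E. exec (While e c) s' (L s')"
    have DE: "D = E" by (rule WhileTrue.IH(1)[OF E])
    have KL: "K s' = L s'" if "(s', t) \<in> set_pmf D" for s' t
      using bspec[OF WhileTrue.IH(2) that] bspec[OF L that[unfolded DE]] unfolding prod.case by blast
    show ?case unfolding D' DE[symmetric]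
      by (rule arg_cong[where f = "add_cost (cost_expr s e)"], rule bind_cost_cong, rule KL)
  qed
qed

text \<open>
  Rationals are passed as numerator and denominator in lowest terms.  The input is placed in
  array 0, all other cells are initially 0.  The answer is the quotient of cell 0 of array 1
  and cell 0 of array 2 (and 0 if the latter is 0).
\<close>

definition encode_rats :: "rat list \<Rightarrow> int list" where
  "encode_rats rs = concat (map (\<lambda>r. [fst (quotient_of r), snd (quotient_of r)]) rs)"

definition encode_input :: "rat \<Rightarrow> rat \<Rightarrow> rat list \<Rightarrow> rat list \<Rightarrow> int list" where
  "encode_input \<epsilon> \<delta> p q = int (length p) # encode_rats ([\<epsilon>, \<delta>] @ p @ q)"

definition input_size :: "int list \<Rightarrow> nat" where
  "input_size zs = (\<Sum>z\<leftarrow>zs. bit_length z)"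

definition initial_store :: "int list \<Rightarrow> store" where
  "initial_store zs = (\<lambda>x i. if x = 0 \<and> 0 \<le> i \<and> i < int (length zs) then zs ! nat i else 0)"

definition answer :: "store \<Rightarrow> real" where
  "answer s = of_int (s 1 0) / of_int (s 2 0)"

definition tv_dist :: "'a set \<Rightarrow> 'a pmf \<Rightarrow> 'a pmf \<Rightarrow> real" where
  "tv_dist S P Q = (\<Sum>x\<in>S. \<bar>pmf P x - pmf Q x\<bar>) / 2"

text \<open>
  The set of 0-1-vectors of length \<open>n\<close>, as functions that are \<open>False\<close> outside \<open>{..<n}\<close>: this is
  where \<open>Pi_pmf {..<n} False\<close> lives.
\<close>

definition cube :: "nat \<Rightarrow> (nat \<Rightarrow> bool) set" where
  "cube n = PiE_dflt {..<n} False (\<lambda>_. UNIV)"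

definition prod_bern :: "rat list \<Rightarrow> (nat \<Rightarrow> bool) pmf" where
  "prod_bern p = Pi_pmf {..<length p} False (\<lambda>i. bernoulli_pmf (of_rat (p ! i)))"

lemma pmf_prod_bern:
  assumes "set p \<subseteq> {0..1}" and "x \<in> cube (length p)"
  shows "pmf (prod_bern p) x =
    (\<Prod>i | i < length p \<and> x i. of_rat (p ! i)) *
    (\<Prod>i | i < length p \<and> \<not> x i. 1 - of_rat (p ! i))"
proof -
  have b: "0 \<le> (of_rat (p ! i) :: real) \<and> (of_rat (p ! i) :: real) \<le> 1" if "i < length p" for i
    using assms(1) nth_mem[OF that] by (auto simp: subset_iff)
  have "pmf (prod_bern p) x = (\<Prod>i<length p. pmf (bernoulli_pmf (of_rat (p ! i))) (x i))"
    unfolding prod_bern_def using assms(2) by (intro pmf_Pi') (auto simp: cube_def PiE_dflt_def)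
  also have "\<dots> = (\<Prod>i<length p. if x i then of_rat (p ! i) else 1 - of_rat (p ! i))"
    using b by (intro prod.cong) auto
  also have "\<dots> = (\<Prod>i\<in>{..<length p} \<inter> {i. x i}. of_rat (p ! i)) *
      (\<Prod>i\<in>{..<length p} \<inter> - {i. x i}. 1 - of_rat (p ! i))"
    by (rule prod.If_cases) simp
  also have "{..<length p} \<inter> {i. x i} = {i. i < length p \<and> x i}" by auto
  also have "{..<length p} \<inter> - {i. x i} = {i. i < length p \<and> \<not> x i}" by auto
  finally show ?thesis .
qed

end

theory Submission
  imports Defs
begin

text \<open>
  For a partial assignment of the coordinates let \<open>(a, b)\<close> be its weights under \<open>P\<close> and \<open>Q\<close>; the
  completions of that assignment contribute a convex, homogeneous function of \<open>(a, b)\<close> to the total variation.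
  Sweeping over the coordinates, all vectors with the same sign of \<open>a - b\<close> and the same value of
  \<open>\<bar>a - b\<bar> / (a + b)\<close> up to a factor \<open>1 + 1 / M\<close> are replaced by their sum.  By convexity this
  cannot increase the total, and since the contribution is Lipschitz in the direction and at least
  \<open>\<bar>a - b\<bar>\<close>, it loses at most a fraction \<open>1 / M\<close> of it.  With \<open>M \<ge> n / \<epsilon>\<close> the loss over all rounds
  is at most a fraction \<open>\<epsilon>\<close>.  The number of buckets is polynomial because the weights, scaled to
  integers, have polynomially many bits.
\<close>

subsection \<open>Bit lengths\<close>

text \<open>The distance can be exponentially small, so no additive error is affordable: each loss
  has to be charged to a quantity that the distance dominates, here
  \<open>\<bar>a - b\<bar>\<close>. This rules out bucketing by the ratio \<open>a / b\<close>. Near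
  \<open>a = b\<close> a tiny relative change of that ratio may alter \<open>a - b\<close> by far
  more than its own size, whereas knowing \<open>\<bar>a - b\<bar> / (a + b)\<close> up to a factor
  \<open>1 + 1 / M\<close> makes merging cost at most \<open>\<bar>a - b\<bar> / M\<close>.
  Integrality is what keeps this finer scale short: if \<open>a \<noteq> b\<close>, then
  \<open>\<bar>a - b\<bar> \<ge> 1\<close>, so the ratio cannot be smaller than the inverse of the
  total weight. Sums of integer vectors are exact and directions are compared by cross
  multiplication, hence there is no rounding and merging is the only source of error. The rounds
  compound to the factor \<open>(1 - 1 / M) ^ n\<close>, which Bernoulli's inequality bounds below
  by \<open>1 - n / M\<close>. The program draws no random bits. Its result is a point mass, and
  correctness reduces to a Hoare-style argument for a deterministic run.\<close>

lemma bit_length_pos: "0 < bit_length z"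
  by (simp add: bit_length_def)

lemma bit_length_mono: "\<bar>a\<bar> \<le> \<bar>b\<bar> \<Longrightarrow> bit_length a \<le> bit_length b"
  by (auto simp: bit_length_def intro!: floorlog_mono)

lemma bit_length_le_Suc_iff: "bit_length z \<le> Suc k \<longleftrightarrow> \<bar>z\<bar> < 2 ^ k"
  by (simp add: bit_length_def nat_less_iff floorlog_le_iff)

lemma abs_less_two_power_bit_length: "\<bar>z\<bar> < 2 ^ (bit_length z - 1)"
  using bit_length_le_Suc_iff[of z "bit_length z - 1"] by (simp add: bit_length_def)

lemma abs_le_two_power_bit_length: "\<bar>z\<bar> \<le> 2 ^ bit_length z"
proof -
  have "(2::int) ^ (bit_length z - 1) \<le> 2 ^ bit_length z"
    by (rule power_increasing) auto
  then show ?thesis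
    using abs_less_two_power_bit_length[of z] by linarith
qed

text \<open>The crude sum of the lengths, rather than the maximum plus one, is the form that also
  fits multiplication, so that one bound serves all operations. Zero operands are separate because
  the estimate needs both powers of two to be at least 2.\<close>

lemma bit_length_add: "bit_length (a + b) \<le> bit_length a + bit_length b"
proof (cases "a = 0 \<or> b = 0")
  case False
  obtain m n where mn: "bit_length a = Suc m" "bit_length b = Suc n"
    by (auto simp: bit_length_def)
  have ab: "\<bar>a\<bar> < 2 ^ m" "\<bar>b\<bar> < 2 ^ n"
    using mn bit_length_le_Suc_iff by (metis order_refl)+
  then have *: "(1::int) \<le> \<bar>a\<bar>" "(1::int) \<le> \<bar>b\<bar>" "(2::int) \<le> 2 ^ m" "(2::int) \<le> 2 ^ n"
    using False by auto
  have "\<bar>a + b\<bar> < 2 ^ m + 2 ^ n"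
    using ab by linarith
  \<comment> \<open>Expand \<open>(2 ^ m - 1) * (2 ^ n - 1) \<ge> 1\<close>.\<close>
  also have "(2::int) ^ m + 2 ^ n \<le> 2 ^ m * 2 ^ n"
    using mult_mono[of 1 "2 ^ m - (1::int)" 1 "2 ^ n - 1"] * by (simp add: algebra_simps)
  also have "\<dots> \<le> 2 ^ (Suc (m + n))"
    by (simp add: power_add)
  finally show ?thesis
    using bit_length_le_Suc_iff[of "a + b" "Suc (m + n)"] mn by simp
qed (auto simp: bit_length_def)

lemma bit_length_mult: "bit_length (a * b) \<le> bit_length a + bit_length b"
proof -
  obtain m n where mn: "bit_length a = Suc m" "bit_length b = Suc n"
    by (auto simp: bit_length_def)
  then have "\<bar>a\<bar> < 2 ^ m" "\<bar>b\<bar> < 2 ^ n"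
    using bit_length_le_Suc_iff by (metis order_refl)+
  then have "\<bar>a * b\<bar> < 2 ^ m * 2 ^ n"
    unfolding abs_mult by (intro mult_strict_mono) auto
  also have "\<dots> \<le> 2 ^ (Suc (m + n))"
    by (simp add: power_add)
  finally show ?thesis
    using bit_length_le_Suc_iff[of "a * b" "Suc (m + n)"] mn by simp
qed

lemma abs_div_le: "\<bar>a div b\<bar> \<le> \<bar>a :: int\<bar>"
proof (cases "b = 0")
  case False
  have *: "\<bar>a div b\<bar> \<le> \<bar>a\<bar>" if "0 < b" for a b :: int
    using zdiv_mono2[of a 1 b] zdiv_mono2_neg[of a 1 b] that pos_imp_zdiv_nonneg_iff[of b a]
    by (cases "0 \<le> a") auto
  show ?thesis
  proof (cases "0 < b")
    case True
    then show ?thesis using * by blast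
  next
    case False
    then have "\<bar>(- a) div (- b)\<bar> \<le> \<bar>- a\<bar>"
      using \<open>b \<noteq> 0\<close> by (intro *) auto
    then show ?thesis by simp
  qed
qed simp

lemma bit_length_opval: "bit_length (opval f a b) \<le> bit_length a + bit_length b"
proof (cases f)
  case Sub
  then show ?thesis
    using bit_length_add[of a "- b"] by (simp add: bit_length_def)
next
  case Div
  then show ?thesis
    using bit_length_mono[OF abs_div_le, of a b] by simp
next
  case Less
  have "bit_length (1::int) = 2" "bit_length (0::int) = 1"
    by (simp_all add: bit_length_def compute_floorlog)
  then show ?thesis
    using bit_length_pos[of a] bit_length_pos[of b] Less by (auto split: if_splits)
qed (auto simp: bit_length_add bit_length_mult)

subsection \<open>Weakest preconditions with automatic cost accounting\<close>

definition bounded_store :: "int \<Rightarrow> store \<Rightarrow> bool" where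
  "bounded_store Z s \<longleftrightarrow> (\<forall>x i. \<bar>s x i\<bar> \<le> Z)"

text \<open>Counted in units of \<open>bit_length Z\<close>, where \<open>Z\<close> bounds all
  cells. Hence a \<open>Read\<close> counts 1 whatever its index is, and a constant may count its
  own length because the unit is at least 1.\<close>

fun val_bound :: "expr \<Rightarrow> nat" where
  "val_bound (Const z) = bit_length z"
| "val_bound (Read x i) = 1"
| "val_bound (Op f a b) = val_bound a + val_bound b"

fun cost_bound :: "expr \<Rightarrow> nat" where
  "cost_bound (Const z) = bit_length z"
| "cost_bound (Read x i) = cost_bound i + val_bound i + 1"
| "cost_bound (Op f a b) = cost_bound a + cost_bound b + val_bound a + val_bound b"

lemma bit_length_eval_le:
  assumes "bounded_store Z s"
  shows "bit_length (eval_expr s e) \<le> val_bound e * bit_length Z"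
proof (induction e)
  case (Const z)
  then show ?case using bit_length_pos[of Z] by simp
next
  case (Read x i)
  have "\<bar>s x (eval_expr s i)\<bar> \<le> \<bar>Z\<bar>"
    using assms by (meson abs_ge_self bounded_store_def order_trans)
  then show ?case by (simp add: bit_length_mono)
next
  case (Op f a b)
  then show ?case
    using bit_length_opval[of f "eval_expr s a" "eval_expr s b"] by (simp add: algebra_simps)
qed

lemma cost_expr_le:
  assumes "bounded_store Z s"
  shows "cost_expr s e \<le> cost_bound e * bit_length Z"
proof (induction e)
  case (Const z)
  then show ?case using bit_length_pos[of Z] by simp
next
  case (Read x i)
  then show ?case
    using bit_length_eval_le[OF assms, of i] bit_length_eval_le[OF assms, of "Read x i"]
    by (simp add: algebra_simps)
next
  case (Op f a b)
  then show ?case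
    using bit_length_eval_le[OF assms, of a] bit_length_eval_le[OF assms, of b]
    by (simp add: algebra_simps)
qed

text \<open>
  The running time of a program all of whose loops make at most \<open>B\<close> iterations, in units of the
  bit length of the largest number it stores.
\<close>

fun time_bound :: "nat \<Rightarrow> com \<Rightarrow> nat" where
  "time_bound B Skip = 1"
| "time_bound B (Write x i e) = cost_bound i + cost_bound e + val_bound i + val_bound e"
| "time_bound B (Toss x) = 1"
| "time_bound B (Seq c c') = time_bound B c + time_bound B c'"
| "time_bound B (Cond e c c') = cost_bound e + time_bound B c + time_bound B c'"
| "time_bound B (While e c) = Suc B * (cost_bound e + time_bound B c)"

text \<open>Only \<open>While\<close> contributes a factor \<open>Suc B\<close>, so the number of
  loops in the fixed program bounds the degree. Adding the exponents in \<open>Seq\<close> and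
  \<open>Cond\<close> is wasteful but yields a common exponent at once.\<close>

lemma time_bound_poly: "\<exists>K d. \<forall>B. time_bound B c \<le> K * Suc B ^ d"
proof (induction c)
  case (Seq c c')
  then obtain K d K' d' where
    *: "\<And>B. time_bound B c \<le> K * Suc B ^ d" "\<And>B. time_bound B c' \<le> K' * Suc B ^ d'"
    by auto
  have "time_bound B (Seq c c') \<le> (K + K') * Suc B ^ (d + d')" for B
  proof -
    have "K * Suc B ^ d \<le> K * Suc B ^ (d + d')" "K' * Suc B ^ d' \<le> K' * Suc B ^ (d + d')"
      by (intro mult_le_mono2 power_increasing; simp)+
    then show ?thesis
      using *(1)[of B] *(2)[of B] unfolding time_bound.simps add_mult_distrib power_0 mult_1_right by linarith
  qed
  then show ?case by blast
next
  case (Cond e c c')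
  then obtain K d K' d' where
    *: "\<And>B. time_bound B c \<le> K * Suc B ^ d" "\<And>B. time_bound B c' \<le> K' * Suc B ^ d'"
    by auto
  have "time_bound B (Cond e c c') \<le> (cost_bound e + K + K') * Suc B ^ (d + d')" for B
  proof -
    have "K * Suc B ^ d \<le> K * Suc B ^ (d + d')" "K' * Suc B ^ d' \<le> K' * Suc B ^ (d + d')"
      "cost_bound e * Suc B ^ 0 \<le> cost_bound e * Suc B ^ (d + d')"
      by (intro mult_le_mono2 power_increasing; simp)+
    then show ?thesis
      using *(1)[of B] *(2)[of B] unfolding time_bound.simps add_mult_distrib power_0 mult_1_right by linarith
  qed
  then show ?case by blast
next
  case (While e c)
  then obtain K d where *: "\<And>B. time_bound B c \<le> K * Suc B ^ d"
    by auto
  have "time_bound B (While e c) \<le> (cost_bound e + K) * Suc B ^ Suc d" for B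
  proof -
    have "cost_bound e * Suc B ^ 0 \<le> cost_bound e * Suc B ^ d"
      by (intro mult_le_mono2 power_increasing; simp)
    then have "cost_bound e + time_bound B c \<le> (cost_bound e + K) * Suc B ^ d"
      using *[of B] unfolding add_mult_distrib power_0 mult_1_right by linarith
    then have "Suc B * (cost_bound e + time_bound B c) \<le> Suc B * ((cost_bound e + K) * Suc B ^ d)"
      by (rule mult_le_mono2)
    then show ?thesis by (simp add: algebra_simps)
  qed
  then show ?case by blast
next
  case (Write x i e)
  show ?case
    by (rule exI[of _ "time_bound 0 (Write x i e)"], rule exI[of _ 0]) simp
qed (rule exI[of _ 1], rule exI[of _ 0], simp)+

text \<open>
  Costs are part of the judgement, so that verifying a program involves no cost arithmetic: only
  the iterations of each loop and the size of each stored number are to be bounded, by \<open>B\<close> and \<open>Z\<close>.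
\<close>

definition wp :: "nat \<Rightarrow> int \<Rightarrow> com \<Rightarrow> (store \<Rightarrow> bool) \<Rightarrow> store \<Rightarrow> bool" where
  "wp B Z c R s \<longleftrightarrow> (bounded_store Z s \<longrightarrow>
     (\<exists>s' t. exec c s (return_pmf (s', t)) \<and> t \<le> time_bound B c * bit_length Z \<and>
       bounded_store Z s' \<and> R s'))"

lemma wp_mono: "wp B Z c R s \<Longrightarrow> (\<And>s'. R s' \<Longrightarrow> R' s') \<Longrightarrow> wp B Z c R' s"
  unfolding wp_def by blast

lemma wp_Write:
  assumes "\<bar>eval_expr s e\<bar> \<le> Z" "R (put s x (eval_expr s i) (eval_expr s e))"
  shows "wp B Z (Write x i e) R s"
  unfolding wp_def
proof (intro impI exI conjI)
  assume b: "bounded_store Z s"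
  show "exec (Write x i e) s (return_pmf (put s x (eval_expr s i) (eval_expr s e),
       cost_expr s i + cost_expr s e + bit_length (eval_expr s i) + bit_length (eval_expr s e)))"
    by (rule exec.Write)
  show "cost_expr s i + cost_expr s e + bit_length (eval_expr s i) + bit_length (eval_expr s e)
      \<le> time_bound B (Write x i e) * bit_length Z"
    using cost_expr_le[OF b, of i] cost_expr_le[OF b, of e]
      bit_length_eval_le[OF b, of i] bit_length_eval_le[OF b, of e]
    by (simp add: algebra_simps)
  show "bounded_store Z (put s x (eval_expr s i) (eval_expr s e))"
    using b assms(1) by (simp add: bounded_store_def put_def)
qed (rule assms)

lemma wp_Seq:
  assumes "wp B Z c (wp B Z c' R) s"
  shows "wp B Z (Seq c c') R s"
  unfolding wp_def
proof
  assume b: "bounded_store Z s"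
  obtain s' t where 1: "exec c s (return_pmf (s', t))" "t \<le> time_bound B c * bit_length Z"
    "bounded_store Z s'" "wp B Z c' R s'"
    using assms b unfolding wp_def by blast
  obtain s'' t' where 2: "exec c' s' (return_pmf (s'', t'))" "t' \<le> time_bound B c' * bit_length Z"
    "bounded_store Z s''" "R s''"
    using 1 unfolding wp_def by blast
  \<comment> \<open>A point mass reaches a single intermediate store, so a constant function can
    serve as the continuation.\<close>
  have "exec (Seq c c') s (bind_pmf (return_pmf (s', t))
      (\<lambda>(s1, t). add_cost t ((\<lambda>_. return_pmf (s'', t')) s1)))"
    by (rule exec.Seq) (use 1 2 in auto)
  then have "exec (Seq c c') s (return_pmf (s'', t + t'))"
    by (simp add: bind_return_pmf add_cost_def)
  then show "\<exists>s' t. exec (Seq c c') s (return_pmf (s', t)) \<and>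
      t \<le> time_bound B (Seq c c') * bit_length Z \<and> bounded_store Z s' \<and> R s'"
    using 1 2 by (intro exI[of _ s''] exI[of _ "t + t'"]) (simp add: algebra_simps)
qed

text \<open>Induction on the variant \<open>\<mu>\<close>, which bounds the remaining iterations.
  The guard is evaluated once more than the body, whence \<open>Suc (\<mu> s)\<close>.\<close>

lemma wp_While_aux:
  fixes \<mu> :: "store \<Rightarrow> nat"
  assumes step: "\<And>s. I s \<Longrightarrow> eval_expr s e \<noteq> 0 \<Longrightarrow> wp B Z c (\<lambda>s'. I s' \<and> \<mu> s' < \<mu> s) s"
  shows "I s \<Longrightarrow> bounded_store Z s \<Longrightarrow>
    \<exists>s' t. exec (While e c) s (return_pmf (s', t)) \<and>
      t \<le> Suc (\<mu> s) * (cost_bound e + time_bound B c) * bit_length Z \<and>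
      bounded_store Z s' \<and> I s' \<and> eval_expr s' e = 0"
proof (induction "\<mu> s" arbitrary: s rule: less_induct)
  case less
  show ?case
  proof (cases "eval_expr s e = 0")
    case True
    then have "exec (While e c) s (return_pmf (s, cost_expr s e))"
      by (rule exec.WhileFalse)
    moreover have "cost_expr s e \<le> Suc (\<mu> s) * (cost_bound e + time_bound B c) * bit_length Z"
      using cost_expr_le[OF less.prems(2), of e] by (simp add: algebra_simps)
    ultimately show ?thesis
      using True less.prems by blast
  next
    case False
    obtain s' t where 1: "exec c s (return_pmf (s', t))" "t \<le> time_bound B c * bit_length Z"
      "bounded_store Z s'" "I s'" "\<mu> s' < \<mu> s"
      using step[OF less.prems(1) False] less.prems unfolding wp_def by blast
    obtain s'' t' where 2: "exec (While e c) s' (return_pmf (s'', t'))"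
      "t' \<le> Suc (\<mu> s') * (cost_bound e + time_bound B c) * bit_length Z"
      "bounded_store Z s''" "I s''" "eval_expr s'' e = 0"
      using less.hyps[OF 1(5,4,3)] by blast
    have "exec (While e c) s (add_cost (cost_expr s e) (bind_pmf (return_pmf (s', t))
        (\<lambda>(s1, t). add_cost t ((\<lambda>_. return_pmf (s'', t')) s1))))"
      by (rule exec.WhileTrue[OF False]) (use 1 2 in auto)
    then have "exec (While e c) s (return_pmf (s'', cost_expr s e + (t + t')))"
      by (simp add: bind_return_pmf add_cost_def)
    moreover have "cost_expr s e + (t + t')
        \<le> Suc (\<mu> s) * (cost_bound e + time_bound B c) * bit_length Z"
    proof -
      have "cost_expr s e + (t + t') \<le> Suc (Suc (\<mu> s')) * (cost_bound e + time_bound B c) * bit_length Z"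
        using 1(2) 2(2) cost_expr_le[OF less.prems(2), of e] by (simp add: algebra_simps)
      also have "\<dots> \<le> Suc (\<mu> s) * (cost_bound e + time_bound B c) * bit_length Z"
        using 1(5) by (intro mult_le_mono1) simp
      finally show ?thesis .
    qed
    ultimately show ?thesis
      using 2 by blast
  qed
qed

lemma wp_While:
  fixes \<mu> :: "store \<Rightarrow> nat"
  assumes "I s" "\<mu> s \<le> B"
    and "\<And>s. I s \<Longrightarrow> eval_expr s e \<noteq> 0 \<Longrightarrow> wp B Z c (\<lambda>s'. I s' \<and> \<mu> s' < \<mu> s) s"
    and "\<And>s. I s \<Longrightarrow> eval_expr s e = 0 \<Longrightarrow> R s"
  shows "wp B Z (While e c) R s"
  unfolding wp_def
proof
  assume "bounded_store Z s"
  then obtain s' t where 1: "exec (While e c) s (return_pmf (s', t))"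
    "t \<le> Suc (\<mu> s) * (cost_bound e + time_bound B c) * bit_length Z"
    "bounded_store Z s'" "I s'" "eval_expr s' e = 0"
    using wp_While_aux[where I = I and \<mu> = \<mu> and s = s, OF assms(3)] assms(1) by metis
  note 1(2)
  also have "Suc (\<mu> s) * (cost_bound e + time_bound B c) * bit_length Z
      \<le> time_bound B (While e c) * bit_length Z"
    unfolding time_bound.simps using assms(2) by (intro mult_le_mono1) simp
  finally show "\<exists>s' t. exec (While e c) s (return_pmf (s', t)) \<and>
      t \<le> time_bound B (While e c) * bit_length Z \<and> bounded_store Z s' \<and> R s'"
    using 1 assms(4) by blast
qed

abbreviation Var :: "nat \<Rightarrow> expr" where
  "Var x \<equiv> Read x (Const 0)"

abbreviation Assign :: "nat \<Rightarrow> expr \<Rightarrow> com" where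
  "Assign x e \<equiv> Write x (Const 0) e"

definition For :: "nat \<Rightarrow> nat \<Rightarrow> com \<Rightarrow> com" where
  "For j hi c = While (Op Less (Var j) (Var hi)) (Seq c (Assign j (Op Add (Var j) (Const 1))))"

text \<open>The invariant is indexed by the counter and demanded for the store in which the counter
  has already been advanced, so the increment never has to be treated again. The bounds on the two
  ends of the range ensure that every counter value fits below \<open>Z\<close>.\<close>

lemma wp_For:
  assumes init: "I (s j 0) s" "s hi 0 = h" "s j 0 \<le> h" "nat (h - s j 0) \<le> B"
    and "j \<noteq> hi" "\<bar>s j 0\<bar> \<le> Z" "\<bar>h\<bar> \<le> Z"
    and step: "\<And>i s'. s j 0 \<le> i \<Longrightarrow> i < h \<Longrightarrow> s' j 0 = i \<Longrightarrow> s' hi 0 = h \<Longrightarrow> I i s' \<Longrightarrow>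
       wp B Z c (\<lambda>s''. s'' j 0 = i \<and> s'' hi 0 = h \<and> I (i + 1) (put s'' j 0 (i + 1))) s'"
    and post: "\<And>s'. I h s' \<Longrightarrow> R s'"
  shows "wp B Z (For j hi c) R s"
  unfolding For_def
proof (rule wp_While[where \<mu> = "\<lambda>s. nat (h - s j 0)" and
      I = "\<lambda>s'. s j 0 \<le> s' j 0 \<and> s' j 0 \<le> h \<and> s' hi 0 = h \<and> I (s' j 0) s'"], goal_cases)
  case 1
  then show ?case using init by simp
next
  case 2
  then show ?case using init by simp
next
  case (3 s')
  then have *: "s j 0 \<le> s' j 0" "s' j 0 < h"
    by (auto split: if_splits)
  show ?case
  proof (rule wp_Seq, rule wp_mono[OF step[OF *]], goal_cases)
    case (4 s'')
    then show ?case
      using * \<open>j \<noteq> hi\<close> \<open>\<bar>s j 0\<bar> \<le> Z\<close> \<open>\<bar>h\<bar> \<le> Z\<close> by (intro wp_Write) (auto simp: put_def)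
  qed (use 3 in auto)
next
  case (4 s')
  then have "s' j 0 = h"
    by (auto split: if_splits)
  with 4 show ?case
    by (intro post) simp
qed

subsection \<open>Total variation by peeling off coordinates\<close>

text \<open>The contribution of all completions of a partial assignment with weights
  \<open>a\<close> and \<open>b\<close> when the coordinates below \<open>m\<close> are still free.
  Coordinates are fixed from the top down, so \<open>m\<close> also counts what remains. The
  recursive form turns the needed properties into short inductions.\<close>

primrec l1_dist :: "(nat \<Rightarrow> real) \<Rightarrow> (nat \<Rightarrow> real) \<Rightarrow> nat \<Rightarrow> real \<Rightarrow> real \<Rightarrow> real" where
  "l1_dist p q 0 a b = \<bar>a - b\<bar>"
| "l1_dist p q (Suc m) a b =
     l1_dist p q m (a * p m) (b * q m) + l1_dist p q m (a * (1 - p m)) (b * (1 - q m))"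

lemma mem_cube_iff: "x \<in> cube m \<longleftrightarrow> (\<forall>i\<ge>m. \<not> x i)"
  by (simp add: cube_def PiE_dflt_def not_less)

lemma cube_0: "cube 0 = {\<lambda>_. False}"
  by (auto simp: mem_cube_iff)

lemma cube_Suc: "cube (Suc m) = cube m \<union> (\<lambda>x. x(m := True)) ` cube m"
proof (intro equalityI subsetI)
  fix x assume x: "x \<in> cube (Suc m)"
  show "x \<in> cube m \<union> (\<lambda>x. x(m := True)) ` cube m"
  proof (cases "x m")
    case True
    then have "x = (x(m := False))(m := True)" by (simp add: fun_upd_idem)
    moreover have "x(m := False) \<in> cube m" using x by (simp add: mem_cube_iff)
    ultimately show ?thesis by blast
  next
    case False
    have "\<not> x i" if "m \<le> i" for i
      using x False that by (cases "i = m") (auto simp: mem_cube_iff)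
    then show ?thesis by (simp add: mem_cube_iff)
  qed
qed (auto simp: mem_cube_iff)

lemma finite_cube: "finite (cube m)"
  by (induction m) (auto simp: cube_0 cube_Suc)

lemma sum_cube_Suc:
  "(\<Sum>x\<in>cube (Suc m). f x) = (\<Sum>x\<in>cube m. f x) + (\<Sum>x\<in>cube m. f (x(m := True)))"
proof -
  have F: "\<not> x m" if "x \<in> cube m" for x
    using that by (simp add: mem_cube_iff)
  have "cube m \<inter> (\<lambda>x. x(m := True)) ` cube m = {}"
    using F by fastforce
  moreover have "inj_on (\<lambda>x. x(m := True)) (cube m)"
  proof (rule inj_onI)
    fix x y assume xy: "x \<in> cube m" "y \<in> cube m" and eq: "x(m := True) = y(m := True)"
    have "x i = y i" for i
      using F[OF xy(1)] F[OF xy(2)] fun_cong[OF eq, of i] by (cases "i = m") simp_all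
    then show "x = y" by blast
  qed
  ultimately show ?thesis
    unfolding cube_Suc by (simp add: sum.union_disjoint finite_cube sum.reindex)
qed

lemma l1_dist_eq_sum:
  "l1_dist p q m a b = (\<Sum>x\<in>cube m. \<bar>a * (\<Prod>i<m. if x i then p i else 1 - p i)
      - b * (\<Prod>i<m. if x i then q i else 1 - q i)\<bar>)"
proof (induction m arbitrary: a b)
  case 0
  then show ?case by (simp add: cube_0)
next
  case (Suc m)
  have F: "\<not> x m" if "x \<in> cube m" for x
    using that by (simp add: mem_cube_iff)
  have U: "(\<Prod>i<m. if (x(m := True)) i then p i else 1 - p i) = (\<Prod>i<m. if x i then p i else 1 - p i)"
    for x and p :: "nat \<Rightarrow> real"
    by (intro prod.cong) auto
  have "(\<Sum>x\<in>cube m. \<bar>a * (\<Prod>i<Suc m. if x i then p i else 1 - p i)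
        - b * (\<Prod>i<Suc m. if x i then q i else 1 - q i)\<bar>) = l1_dist p q m (a * (1 - p m)) (b * (1 - q m))"
    unfolding Suc prod.lessThan_Suc by (intro sum.cong refl) (simp add: F mult_ac)
  moreover have "(\<Sum>x\<in>cube m. \<bar>a * (\<Prod>i<Suc m. if (x(m := True)) i then p i else 1 - p i)
        - b * (\<Prod>i<Suc m. if (x(m := True)) i then q i else 1 - q i)\<bar>) = l1_dist p q m (a * p m) (b * q m)"
    unfolding Suc prod.lessThan_Suc U by (intro sum.cong refl) (simp add: mult_ac)
  ultimately show ?case
    unfolding sum_cube_Suc l1_dist.simps by linarith
qed

text \<open>The functions \<open>p'\<close> and \<open>q'\<close> are tied to the lists only within
  range, which leaves room for total functions with padding.\<close>

lemma tv_dist_prod_bern: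
  assumes len: "length p = length q" and pq: "set p \<subseteq> {0..1}" "set q \<subseteq> {0..1}"
    and p': "\<And>i. i < length p \<Longrightarrow> p' i = of_rat (p ! i)"
    and q': "\<And>i. i < length q \<Longrightarrow> q' i = of_rat (q ! i)"
  shows "tv_dist (cube (length p)) (prod_bern p) (prod_bern q) = l1_dist p' q' (length p) 1 1 / 2"
proof -
  have *: "pmf (prod_bern r) x = (\<Prod>i<length r. if x i then r' i else 1 - r' i)"
    if "x \<in> cube (length r)" "set r \<subseteq> {0..1}" "\<And>i. i < length r \<Longrightarrow> r' i = of_rat (r ! i)"
    for r x and r' :: "nat \<Rightarrow> real"
  proof -
    have "(\<Prod>i<length r. if x i then r' i else 1 - r' i) =
        (\<Prod>i<length r. if x i then of_rat (r ! i) else 1 - of_rat (r ! i))"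
      using that(3) by (intro prod.cong) auto
    also have "\<dots> = (\<Prod>i\<in>{..<length r} \<inter> {i. x i}. of_rat (r ! i)) *
      (\<Prod>i\<in>{..<length r} \<inter> - {i. x i}. 1 - of_rat (r ! i))"
      by (rule prod.If_cases) simp
    also have "{..<length r} \<inter> {i. x i} = {i. i < length r \<and> x i}" by auto
    also have "{..<length r} \<inter> - {i. x i} = {i. i < length r \<and> \<not> x i}" by auto
    finally show ?thesis
      using pmf_prod_bern[OF that(2,1)] by simp
  qed
  have "(\<Sum>x\<in>cube (length p). \<bar>pmf (prod_bern p) x - pmf (prod_bern q) x\<bar>) =
      l1_dist p' q' (length p) 1 1"
    unfolding l1_dist_eq_sum mult_1
    using *[OF _ pq(1) p'] *[OF _ pq(2) q'] len by (intro sum.cong refl) simp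
  then show ?thesis
    by (simp add: tv_dist_def)
qed

lemma l1_dist_scale: "0 \<le> c \<Longrightarrow> l1_dist p q m (c * a) (c * b) = c * l1_dist p q m a b"
proof (induction m arbitrary: a b)
  case 0
  then show ?case by (simp add: abs_mult flip: right_diff_distrib)
qed (simp add: mult.assoc distrib_left)

lemma l1_dist_nonneg: "0 \<le> l1_dist p q m a b"
  by (induction m arbitrary: a b) simp_all

text \<open>Together with \<open>l1_dist_scale\<close> this is convexity in the form used below: the
  triangle inequality, carried through the linear maps of the recursion.\<close>

lemma l1_dist_add:
  "l1_dist p q m (a + a') (b + b') \<le> l1_dist p q m a b + l1_dist p q m a' b'"
proof (induction m arbitrary: a b a' b')
  case (Suc m)
  show ?case
    using Suc[of "a * p m" "a' * p m" "b * q m" "b' * q m"]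
      Suc[of "a * (1 - p m)" "a' * (1 - p m)" "b * (1 - q m)" "b' * (1 - q m)"]
    by (simp add: distrib_right)
qed simp

lemma l1_dist_zero: "l1_dist p q m 0 0 = 0"
  by (induction m) simp_all

lemma l1_dist_sum:
  "finite I \<Longrightarrow> l1_dist p q m (\<Sum>i\<in>I. a i) (\<Sum>i\<in>I. b i) \<le> (\<Sum>i\<in>I. l1_dist p q m (a i) (b i))"
proof (induction I rule: finite_induct)
  case (insert x F)
  then show ?case
    using l1_dist_add[of p q m "a x" "sum a F" "b x" "sum b F"] by simp
qed (simp add: l1_dist_zero)

text \<open>The two branches of a coordinate add up to \<open>(a, b)\<close> again, so splitting can
  only undo cancellation. This is what converts errors measured by \<open>\<bar>a - b\<bar>\<close>
  into relative errors.\<close>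

lemma l1_dist_ge: "\<bar>a - b\<bar> \<le> l1_dist p q m a b"
proof (induction m arbitrary: a b)
  case (Suc m)
  have "\<bar>a - b\<bar> \<le> \<bar>a * p m - b * q m\<bar> + \<bar>a * (1 - p m) - b * (1 - q m)\<bar>"
    using abs_triangle_ineq[of "a * p m - b * q m" "a * (1 - p m) - b * (1 - q m)"]
    by (simp add: algebra_simps)
  then show ?case
    using Suc[of "a * p m" "b * q m"] Suc[of "a * (1 - p m)" "b * (1 - q m)"] by simp
qed simp

text \<open>Splitting preserves both masses. Combined with \<open>l1_dist_add\<close> this gives
  Lipschitz constant 1 for the l1 norm.\<close>

lemma l1_dist_le:
  assumes "\<And>i. 0 \<le> p i" "\<And>i. p i \<le> 1" "\<And>i. 0 \<le> q i" "\<And>i. q i \<le> 1"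
  shows "l1_dist p q m a b \<le> \<bar>a\<bar> + \<bar>b\<bar>"
proof (induction m arbitrary: a b)
  case (Suc m)
  have "\<bar>a * p m\<bar> + \<bar>a * (1 - p m)\<bar> = \<bar>a\<bar>" "\<bar>b * q m\<bar> + \<bar>b * (1 - q m)\<bar> = \<bar>b\<bar>"
    using assms by (simp_all add: abs_mult flip: distrib_left)
  then show ?case
    using Suc[of "a * p m" "b * q m"] Suc[of "a * (1 - p m)" "b * (1 - q m)"] by simp
qed simp

subsection \<open>Merging vectors of nearly equal direction\<close>

text \<open>
  Replacing each vector by the multiple of the total that has the same coordinate sum moves it
  along the antidiagonal, where \<open>l1_dist\<close> is 1-Lipschitz.
\<close>

lemma l1_dist_merge_bucket:
  fixes a b :: "'i \<Rightarrow> real"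
  assumes p: "\<And>i. 0 \<le> p i" "\<And>i. p i \<le> 1" and q: "\<And>i. 0 \<le> q i" "\<And>i. q i \<le> 1"
    and I: "finite I" and M: "0 < M" and ab: "\<And>i. i \<in> I \<Longrightarrow> 0 \<le> a i" "\<And>i. i \<in> I \<Longrightarrow> 0 \<le> b i"
    and near: "\<And>i j. i \<in> I \<Longrightarrow> j \<in> I \<Longrightarrow>
      M * \<bar>(a i - b i) * (a j + b j) - (a j - b j) * (a i + b i)\<bar> \<le> \<bar>a i - b i\<bar> * (a j + b j)"
  shows "(\<Sum>i\<in>I. l1_dist p q m (a i) (b i)) \<le>
    l1_dist p q m (\<Sum>i\<in>I. a i) (\<Sum>i\<in>I. b i) + (\<Sum>i\<in>I. \<bar>a i - b i\<bar>) / M"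
proof -
  define A B Y where "A = (\<Sum>i\<in>I. a i)" and "B = (\<Sum>i\<in>I. b i)" and "Y = (\<Sum>i\<in>I. a i + b i)"
  have Y: "Y = A + B" "0 \<le> Y"
    using ab by (simp_all add: A_def B_def Y_def sum.distrib sum_nonneg)
  show ?thesis
  proof (cases "Y = 0")
    case True
    then have "a i + b i = 0" if "i \<in> I" for i
      using that ab I sum_nonneg_eq_0_iff[of I "\<lambda>i. a i + b i"] by (auto simp: Y_def)
    then have "a i = 0 \<and> b i = 0" if "i \<in> I" for i
      using that ab by (metis add_nonneg_eq_0_iff)
    then show ?thesis by (simp add: l1_dist_zero)
  next
    case False
    with Y have pos: "0 < Y" by simp
    have *: "l1_dist p q m (a i) (b i) \<le> (a i + b i) / Y * l1_dist p q m A B + \<bar>a i - b i\<bar> / M"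
      if i: "i \<in> I" for i
    proof -
      \<comment> \<open>The share of vector \<open>i\<close> in the total. The shares add up to 1,
        so the terms recombine to the value at \<open>(A, B)\<close>.\<close>
      define c where "c = (a i + b i) / Y"
      have c: "0 \<le> c" using ab i pos by (simp add: c_def)
      have "l1_dist p q m (a i) (b i) \<le>
          l1_dist p q m (c * A) (c * B) + l1_dist p q m (a i - c * A) (b i - c * B)"
        using l1_dist_add[of p q m "c * A" "a i - c * A" "c * B" "b i - c * B"] by simp
      also have "l1_dist p q m (c * A) (c * B) = c * l1_dist p q m A B"
        by (rule l1_dist_scale[OF c])
      also have "l1_dist p q m (a i - c * A) (b i - c * B) \<le> \<bar>a i - c * A\<bar> + \<bar>b i - c * B\<bar>"
        using p q by (rule l1_dist_le)
      also have "\<bar>a i - c * A\<bar> + \<bar>b i - c * B\<bar> \<le> \<bar>a i - b i\<bar> / M"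
      proof -
        \<comment> \<open>Equal coordinate sums make the displacement of the form
          \<open>(d, -d)\<close>. Its l1 norm is then exactly the change of \<open>a - b\<close>,
          the quantity that \<open>near\<close> controls.\<close>
        have "c * A + c * B = a i + b i"
          using pos by (simp only: Y(1) c_def flip: distrib_left) simp
        then have "b i - c * B = - (a i - c * A)" "(a i - b i) - c * (A - B) = 2 * (a i - c * A)"
          unfolding right_diff_distrib by linarith+
        moreover have "\<bar>u\<bar> + \<bar>v\<bar> = \<bar>w\<bar>" if "v = - u" "w = 2 * u" for u v w :: real
          using that by simp
        ultimately have "\<bar>a i - c * A\<bar> + \<bar>b i - c * B\<bar> = \<bar>(a i - b i) - c * (A - B)\<bar>"
          by blast
        also have "\<dots> = \<bar>(a i - b i) * Y - (A - B) * (a i + b i)\<bar> / Y"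
          using pos by (simp add: c_def field_simps)
        finally have 1: "\<bar>a i - c * A\<bar> + \<bar>b i - c * B\<bar> =
          \<bar>(a i - b i) * Y - (A - B) * (a i + b i)\<bar> / Y" .
        \<comment> \<open>The deviation from the total is the sum over \<open>j\<close> of the
          deviations from the single vectors, so pairwise closeness suffices.\<close>
        have "(a i - b i) * Y - (A - B) * (a i + b i) =
            (\<Sum>j\<in>I. (a i - b i) * (a j + b j) - (a j - b j) * (a i + b i))"
          unfolding A_def B_def Y_def sum_subtractf[symmetric] sum_distrib_left sum_distrib_right ..
        then have "M * \<bar>(a i - b i) * Y - (A - B) * (a i + b i)\<bar> \<le>
            (\<Sum>j\<in>I. M * \<bar>(a i - b i) * (a j + b j) - (a j - b j) * (a i + b i)\<bar>)"
          using M by (simp add: sum_abs flip: sum_distrib_left)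
        also have "\<dots> \<le> (\<Sum>j\<in>I. \<bar>a i - b i\<bar> * (a j + b j))"
          using near i by (intro sum_mono) auto
        also have "\<dots> = \<bar>a i - b i\<bar> * Y"
          by (simp add: Y_def sum_distrib_left)
        finally show ?thesis
          unfolding 1 using M pos by (simp add: field_simps)
      qed
      finally show ?thesis by (simp add: c_def)
    qed
    have "(\<Sum>i\<in>I. l1_dist p q m (a i) (b i)) \<le>
        (\<Sum>i\<in>I. (a i + b i) / Y * l1_dist p q m A B + \<bar>a i - b i\<bar> / M)"
      by (intro sum_mono *)
    also have "\<dots> = Y / Y * l1_dist p q m A B + (\<Sum>i\<in>I. \<bar>a i - b i\<bar>) / M"
      by (simp add: sum.distrib sum_divide_distrib[symmetric] Y_def flip: sum_distrib_right)
    finally show ?thesis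
      using pos by (simp add: A_def B_def)
  qed
qed

text \<open>The upper bound is subadditivity in each class. For the lower bound the losses of the
  classes add up to the sum of all \<open>\<bar>a i - b i\<bar> / M\<close>, which
  \<open>l1_dist_ge\<close> bounds by \<open>T0 / M\<close>. Labels in \<open>T\<close> without
  vectors contribute 0, so a fixed index range can be used.\<close>

lemma l1_dist_merge:
  fixes a b :: "'i \<Rightarrow> real" and c :: "'i \<Rightarrow> 'l" and m :: nat
  assumes p: "\<And>i. 0 \<le> p i" "\<And>i. p i \<le> 1" and q: "\<And>i. 0 \<le> q i" "\<And>i. q i \<le> 1"
    and I: "finite I" "finite T" "c ` I \<subseteq> T" and M: "0 < M"
    and ab: "\<And>i. i \<in> I \<Longrightarrow> 0 \<le> a i" "\<And>i. i \<in> I \<Longrightarrow> 0 \<le> b i"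
    and near: "\<And>i j. i \<in> I \<Longrightarrow> j \<in> I \<Longrightarrow> c i = c j \<Longrightarrow>
      M * \<bar>(a i - b i) * (a j + b j) - (a j - b j) * (a i + b i)\<bar> \<le> \<bar>a i - b i\<bar> * (a j + b j)"
  defines "T0 \<equiv> (\<Sum>i\<in>I. l1_dist p q m (a i) (b i))"
    and "T1 \<equiv> (\<Sum>l\<in>T. l1_dist p q m (\<Sum>i | i \<in> I \<and> c i = l. a i) (\<Sum>i | i \<in> I \<and> c i = l. b i))"
  shows "T1 \<le> T0" "(1 - 1 / M) * T0 \<le> T1"
proof -
  have grp: "(\<Sum>l\<in>T. \<Sum>i | i \<in> I \<and> c i = l. f i) = sum f I" for f :: "'i \<Rightarrow> real"
    using sum.group[OF I] .
  have "T1 \<le> (\<Sum>l\<in>T. \<Sum>i | i \<in> I \<and> c i = l. l1_dist p q m (a i) (b i))"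
    unfolding T1_def using I by (intro sum_mono l1_dist_sum) auto
  also have "\<dots> = T0"
    unfolding T0_def by (rule grp)
  finally show "T1 \<le> T0" .
  have "T0 = (\<Sum>l\<in>T. \<Sum>i | i \<in> I \<and> c i = l. l1_dist p q m (a i) (b i))"
    unfolding T0_def by (rule grp[symmetric])
  also have "\<dots> \<le> (\<Sum>l\<in>T. l1_dist p q m (\<Sum>i | i \<in> I \<and> c i = l. a i) (\<Sum>i | i \<in> I \<and> c i = l. b i)
      + (\<Sum>i | i \<in> I \<and> c i = l. \<bar>a i - b i\<bar>) / M)"
    using I by (intro sum_mono l1_dist_merge_bucket p q M ab near) auto
  also have "\<dots> = T1 + (\<Sum>i\<in>I. \<bar>a i - b i\<bar>) / M"
    unfolding T1_def by (simp add: sum.distrib sum_divide_distrib[symmetric] grp)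
  also have "(\<Sum>i\<in>I. \<bar>a i - b i\<bar>) / M \<le> T0 / M"
    unfolding T0_def using M by (intro divide_right_mono sum_mono l1_dist_ge) auto
  finally show "(1 - 1 / M) * T0 \<le> T1"
    by (simp add: algebra_simps)
qed

section \<open>Geometric bucketing of integer vectors\<close>

text \<open>For positive \<open>M\<close> and \<open>x\<close> and for \<open>x \<le> y\<close>,
  this is the logarithm of \<open>y / x\<close> to base \<open>1 + 1 / M\<close>, rounded up, with
  all divisions cleared. It is applied to \<open>x = \<bar>a - b\<bar>\<close> and
  \<open>y = a + b\<close>.\<close>

definition level :: "nat \<Rightarrow> int \<Rightarrow> int \<Rightarrow> nat" where
  "level M x y = (LEAST j. y * int M ^ j \<le> x * (int M + 1) ^ j)"

text \<open>The shift by 1 keeps the two signs apart at level 0 and reserves index 0 for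
  \<open>a = b\<close>, where the factor \<open>sgn\<close> cancels the then meaningless
  level.\<close>

definition bucket :: "nat \<Rightarrow> int \<Rightarrow> int \<Rightarrow> int" where
  "bucket M a b = sgn (a - b) * (1 + int (level M \<bar>a - b\<bar> (a + b)))"

text \<open>By Bernoulli's inequality \<open>(1 + 1 / M) ^ M \<ge> 2\<close>: every \<open>M\<close>
  steps double the right-hand side relative to the left, and \<open>t\<close> doublings absorb
  \<open>y\<close>.\<close>

lemma level_exists:
  assumes "0 < M" "1 \<le> x" "y \<le> 2 ^ t"
  shows "y * int M ^ (M * t) \<le> x * (int M + 1) ^ (M * t)"
proof -
  have "2 * int M ^ M \<le> (int M + 1) ^ M"
  proof -
    have "(real M + 1) ^ M = (1 + 1 / real M) ^ M * real M ^ M"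
    proof -
      have "(1 + 1 / real M) * real M = real M + 1"
        using assms by (simp add: distrib_right)
      then show ?thesis
        unfolding power_mult_distrib[symmetric] by simp
    qed
    moreover have "2 \<le> (1 + 1 / real M) ^ M"
    proof -
      have "real M * (1 / real M) = 1" using assms by simp
      moreover have "- 1 \<le> 1 / real M" by (rule order_trans[of _ 0]) simp_all
      ultimately show ?thesis
        using Bernoulli_inequality[of "1 / real M" M] by linarith
    qed
    ultimately have "2 * real M ^ M \<le> (real M + 1) ^ M"
      using mult_right_mono[of 2 "(1 + 1 / real M) ^ M" "real M ^ M"] by (simp only: zero_le_power of_nat_0_le_iff)
    then have "real_of_int (2 * int M ^ M) \<le> real_of_int ((int M + 1) ^ M)"
      by (simp del: of_int_le_iff)
    then show ?thesis
      by (simp only: of_int_le_iff)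
  qed
  then have "(2 * int M ^ M) ^ t \<le> ((int M + 1) ^ M) ^ t"
    by (rule power_mono) simp
  then have *: "2 ^ t * int M ^ (M * t) \<le> (int M + 1) ^ (M * t)"
    by (simp add: power_mult_distrib power_mult)
  have "y * int M ^ (M * t) \<le> 2 ^ t * int M ^ (M * t)"
    using assms by (intro mult_right_mono) auto
  also note *
  also have "(int M + 1) ^ (M * t) \<le> x * (int M + 1) ^ (M * t)"
    using assms mult_right_mono[of 1 x "(int M + 1) ^ (M * t)"] by simp
  finally show ?thesis .
qed

lemma level_le: "0 < M \<Longrightarrow> 1 \<le> x \<Longrightarrow> y \<le> 2 ^ t \<Longrightarrow> level M x y \<le> M * t"
  unfolding level_def by (intro Least_le level_exists)

text \<open>Only existence of some exponent matters here, so the wasteful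
  \<open>y \<le> 2 ^ y\<close> may supply the witness.\<close>

lemma level_works:
  assumes "0 < M" "1 \<le> x"
  shows "y * int M ^ level M x y \<le> x * (int M + 1) ^ level M x y"
proof -
  have "y \<le> int (nat y)" by simp
  also have "int (nat y) \<le> 2 ^ nat y"
    by (rule less_imp_le) (rule of_nat_less_two_power)
  finally show ?thesis
    using LeastI[of "\<lambda>j. y * int M ^ j \<le> x * (int M + 1) ^ j" "M * nat y", OF level_exists[OF assms]]
    by (simp only: level_def)
qed

text \<open>At a common level \<open>Suc j\<close> the first vector still fails the test at
  \<open>j\<close> while the second passes it at \<open>Suc j\<close>. Multiplying the two
  inequalities and cancelling the common powers leaves a single factor \<open>(M + 1) / M\<close>.
  At level 0 nothing fails, but then \<open>x = y\<close> and \<open>x' = y'\<close>.\<close>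

lemma level_near:
  assumes x: "0 < M" "0 < x" "x \<le> y" "0 < x'" "x' \<le> y'" and eq: "level M x y = level M x' y'"
  shows "int M * (x * y') \<le> (int M + 1) * (x' * y)"
proof (cases "level M x y")
  case 0
  then have "y \<le> x" "y' \<le> x'"
    using level_works[of M x y] level_works[of M x' y'] eq x by simp_all
  then have "x = y" "x' = y'"
    using x by simp_all
  then show ?thesis
    using x by (simp add: algebra_simps)
next
  case (Suc j)
  have lt: "x * (int M + 1) ^ j < y * int M ^ j"
    using not_less_Least[of j "\<lambda>j. y * int M ^ j \<le> x * (int M + 1) ^ j"] Suc
    by (simp add: level_def not_le)
  have up: "y' * int M ^ Suc j \<le> x' * (int M + 1) ^ Suc j"
    using level_works[of M x' y'] eq x Suc by simp
  have "(x * (int M + 1) ^ j) * (y' * int M ^ Suc j) \<le> (y * int M ^ j) * (x' * (int M + 1) ^ Suc j)"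
  proof (rule mult_mono)
    have "0 < y" using x by simp
    then show "0 \<le> y * int M ^ j" by simp
    have "0 < y'" using x by simp
    then show "0 \<le> y' * int M ^ Suc j" by simp
  qed (fact up | use lt in linarith)+
  then have "(int M * (x * y')) * (int M ^ j * (int M + 1) ^ j)
      \<le> ((int M + 1) * (x' * y)) * (int M ^ j * (int M + 1) ^ j)"
    unfolding power_Suc by (simp only: mult_ac)
  moreover have "0 < int M ^ j * (int M + 1) ^ j"
  proof -
    have "0 \<le> x * (int M + 1) ^ j"
      using x by simp
    with lt have "0 < y * int M ^ j"
      by linarith
    then have "0 < int M ^ j"
      using x by (simp add: zero_less_mult_iff)
    then show ?thesis by simp
  qed
  ultimately show ?thesis
    using mult_le_cancel_right_pos by blast
qed

text \<open>This is the hypothesis \<open>near\<close> of \<open>l1_dist_merge\<close>, over the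
  integers. Equal signs allow passing to absolute values, and \<open>level_near\<close> applies in
  both directions.\<close>

lemma bucket_near:
  assumes ab: "0 < M" "0 \<le> a" "0 \<le> b" "0 \<le> a'" "0 \<le> b'" and eq: "bucket M a b = bucket M a' b'"
  shows "int M * \<bar>(a - b) * (a' + b') - (a' - b') * (a + b)\<bar> \<le> \<bar>a - b\<bar> * (a' + b')"
proof (cases "a = b")
  case True
  then have "bucket M a' b' = 0"
    using eq by (simp add: bucket_def)
  then have "a' = b'"
    by (auto simp: bucket_def sgn_if split: if_splits)
  with True show ?thesis by simp
next
  case False
  have sgn: "sgn (a - b) = sgn (a' - b')"
    and lev: "level M \<bar>a - b\<bar> (a + b) = level M \<bar>a' - b'\<bar> (a' + b')"
    using eq False by (auto simp: bucket_def sgn_if split: if_splits)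
  have "a' \<noteq> b'"
    using sgn False by (auto simp: sgn_if split: if_splits)
  then have near: "int M * (\<bar>a - b\<bar> * (a' + b')) \<le> (int M + 1) * (\<bar>a' - b'\<bar> * (a + b))"
    "int M * (\<bar>a' - b'\<bar> * (a + b)) \<le> (int M + 1) * (\<bar>a - b\<bar> * (a' + b'))"
    using ab False lev by (intro level_near; simp)+
  \<comment> \<open>Subtracting \<open>M\<close> times the smaller number leaves at most one copy of
    it, which is at most \<open>u\<close> in either case.\<close>
  have "int M * \<bar>u - w\<bar> \<le> u" if "int M * u \<le> (int M + 1) * w" "int M * w \<le> (int M + 1) * u" for u w
    using that by (cases "w \<le> u") (simp_all add: algebra_simps)
  from this[OF near] have "int M * \<bar>\<bar>a - b\<bar> * (a' + b') - \<bar>a' - b'\<bar> * (a + b)\<bar> \<le> \<bar>a - b\<bar> * (a' + b')" .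
  moreover have "\<bar>(a - b) * (a' + b') - (a' - b') * (a + b)\<bar> =
      \<bar>\<bar>a - b\<bar> * (a' + b') - \<bar>a' - b'\<bar> * (a + b)\<bar>"
  proof (cases "0 < a - b")
    case True
    with sgn have "0 < a' - b'" by (auto simp: sgn_if split: if_splits)
    with True show ?thesis by simp
  next
    case F: False
    with sgn False have "a' - b' < 0" "a - b < 0" by (auto simp: sgn_if split: if_splits)
    then have "\<bar>a - b\<bar> = - (a - b)" "\<bar>a' - b'\<bar> = - (a' - b')" by simp_all
    then show ?thesis by (simp only: mult_minus_left minus_diff_minus abs_minus_cancel)
  qed
  ultimately show ?thesis by simp
qed

text \<open>Integrality enters here: \<open>a \<noteq> b\<close> gives
  \<open>\<bar>a - b\<bar> \<ge> 1\<close>, as \<open>level_le\<close> requires.\<close>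

lemma abs_bucket_le:
  assumes "0 < M" "0 \<le> a" "0 \<le> b" "a + b \<le> 2 ^ t"
  shows "\<bar>bucket M a b\<bar> \<le> 1 + int (M * t)"
proof (cases "a = b")
  case False
  then have "level M \<bar>a - b\<bar> (a + b) \<le> M * t"
    using assms by (intro level_le) auto
  then have "int (level M \<bar>a - b\<bar> (a + b)) \<le> int (M * t)"
    by (simp only: of_nat_le_iff)
  then show ?thesis
    by (auto simp: bucket_def abs_mult sgn_if)
qed (simp add: bucket_def)

subsection \<open>One round of the sweep\<close>

text \<open>The probabilities are \<open>pn i / pd i\<close> and \<open>qn i / qd i\<close>. The
  conditions on them hold for all \<open>i\<close>, with padding beyond \<open>n\<close> in mind, to
  avoid range conditions later. The role of \<open>S\<close> will be played by the input
  size.\<close>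

locale sweep =
  fixes n S M :: nat and pn pd qn qd :: "nat \<Rightarrow> int"
  assumes M: "0 < M"
    and p: "\<And>i. 0 \<le> pn i" "\<And>i. pn i \<le> pd i" "\<And>i. 0 < pd i"
    and q: "\<And>i. 0 \<le> qn i" "\<And>i. qn i \<le> qd i" "\<And>i. 0 < qd i"
    and S: "(\<Prod>i<n. pd i * qd i) \<le> 2 ^ S" "n \<le> S"
begin

text \<open>The common denominator contributed by the coordinates already fixed, namely
  \<open>m\<close> to \<open>n - 1\<close>.\<close>

definition den :: "nat \<Rightarrow> int" where
  "den m = (\<Prod>i=m..<n. pd i * qd i)"

definition P :: "nat \<Rightarrow> real" where "P i = pn i / pd i"
definition Q :: "nat \<Rightarrow> real" where "Q i = qn i / qd i"

text \<open>Branch probabilities times \<open>pd m * qd m\<close>. Each side carries the denominator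
  of the other distribution so that both weights of a vector are scaled alike and its direction is
  preserved.\<close>

definition wP :: "nat \<Rightarrow> bool \<Rightarrow> int" where
  "wP m c = (if c then pn m * qd m else (pd m - pn m) * qd m)"
definition wQ :: "nat \<Rightarrow> bool \<Rightarrow> int" where
  "wQ m c = (if c then qn m * pd m else (qd m - qn m) * pd m)"

text \<open>Each coordinate of a vector is at most \<open>2 ^ S\<close>, so their sum is at most
  \<open>2 ^ Suc S\<close>. The formula is \<open>abs_bucket_le\<close> with
  \<open>t = Suc S\<close>.\<close>

definition max_bucket :: int where
  "max_bucket = 1 + int (M * Suc S)"

definition weight :: "nat \<Rightarrow> (int \<Rightarrow> int) \<Rightarrow> (int \<Rightarrow> int) \<Rightarrow> real" where
  "weight m A B = (\<Sum>l=-max_bucket..max_bucket. l1_dist P Q m (A l) (B l))"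

text \<open>The two mass equations survive merging and bound each single entry by
  \<open>den m\<close>. The last two conjuncts allow a loss of one factor \<open>1 - 1 / M\<close>
  for each of the \<open>n - m\<close> rounds done.\<close>

definition good :: "nat \<Rightarrow> (int \<Rightarrow> int) \<Rightarrow> (int \<Rightarrow> int) \<Rightarrow> bool" where
  "good m A B \<longleftrightarrow> (\<forall>l. 0 \<le> A l \<and> 0 \<le> B l) \<and>
     (\<Sum>l=-max_bucket..max_bucket. A l) = den m \<and> (\<Sum>l=-max_bucket..max_bucket. B l) = den m \<and>
     weight m A B \<le> l1_dist P Q n 1 1 * den m \<and>
     (1 - 1 / M) ^ (n - m) * (l1_dist P Q n 1 1 * den m) \<le> weight m A B"

definition branch :: "nat \<Rightarrow> (int \<Rightarrow> int) \<Rightarrow> (int \<Rightarrow> int) \<Rightarrow> int \<times> bool \<Rightarrow> int \<times> int" where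
  "branch m A B = (\<lambda>(j, c). (A j * wP m c, B j * wQ m c))"

text \<open>\<open>f\<close> is \<open>fst\<close> or \<open>snd\<close>. The set \<open>I\<close>
  of branches is a parameter because the program inserts them one at a time, and the intermediate
  states have to be described as well.\<close>

definition merged where
  "merged f m A B I l = (\<Sum>x | x \<in> I \<and> case_prod (bucket M) (branch m A B x) = l. f (branch m A B x))"

lemma P: "0 \<le> P i" "P i \<le> 1" and Q: "0 \<le> Q i" "Q i \<le> 1"
  using p[of i] q[of i] by (auto simp: P_def Q_def)

lemma w_nonneg: "0 \<le> wP m c" "0 \<le> wQ m c"
  using p[of m] q[of m] by (auto simp: wP_def wQ_def)

lemma den_pos: "0 < den m"
  unfolding den_def using p q by (intro prod_pos) auto

lemma den_Suc: "m < n \<Longrightarrow> den m = pd m * qd m * den (Suc m)"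
  by (simp add: den_def prod.atLeast_Suc_lessThan)

lemma den_le: "den m \<le> 2 ^ S"
proof -
  have "den m \<le> (\<Prod>i<n. pd i * qd i)"
    unfolding den_def
  proof (rule prod_mono2)
    show "1 \<le> pd i * qd i" for i
      using p(3)[of i] q(3)[of i] by (metis mult_pos_pos int_one_le_iff_zero_less)
    show "0 \<le> pd i * qd i" for i
      using p(3)[of i] q(3)[of i] by simp
  qed auto
  with S(1) show ?thesis by linarith
qed

lemma den_n: "den n = 1"
  by (simp add: den_def)

lemma max_bucket_pos: "2 \<le> max_bucket"
proof -
  have "int 1 \<le> int (M * Suc S)"
    unfolding of_nat_le_iff using M by simp
  then show ?thesis
    unfolding max_bucket_def by linarith
qed

text \<open>The empty assignment is the vector \<open>(1, 1)\<close>, which belongs to bucket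
  0.\<close>

lemma good_init:
  "good n (\<lambda>l. if l = 0 then 1 else 0) (\<lambda>l. if l = 0 then 1 else 0)"
proof -
  have 1: "(\<Sum>l=-max_bucket..max_bucket. if l = 0 then c else 0) = c" for c :: int
    using max_bucket_pos by simp
  have "weight n (\<lambda>l. if l = 0 then 1 else 0) (\<lambda>l. if l = 0 then 1 else 0) =
      (\<Sum>l=-max_bucket..max_bucket. if l = 0 then l1_dist P Q n 1 1 else 0)"
    unfolding weight_def by (intro sum.cong) (auto simp: l1_dist_zero)
  also have "\<dots> = l1_dist P Q n 1 1"
    using max_bucket_pos by simp
  finally show ?thesis
    by (simp add: good_def den_n 1)
qed

text \<open>Mediates between the indices \<open>-L..L\<close> that the program visits and the fixed
  range over which \<open>good\<close> sums.\<close>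

lemma sum_branches:
  assumes "0 \<le> L" "L \<le> max_bucket" "\<And>l. L < \<bar>l\<bar> \<Longrightarrow> g (l, True) + g (l, False) = (0 :: 'c :: comm_monoid_add)"
  shows "(\<Sum>x\<in>{-L..L} \<times> UNIV. g x) = (\<Sum>l=-max_bucket..max_bucket. g (l, True) + g (l, False))"
proof -
  have "(\<Sum>x\<in>{-L..L} \<times> UNIV. g x) = (\<Sum>l=-L..L. \<Sum>c\<in>UNIV. g (l, c))"
    by (simp add: sum.cartesian_product)
  also have "\<dots> = (\<Sum>l=-L..L. g (l, True) + g (l, False))"
    by (simp add: UNIV_bool add.commute)
  also have "\<dots> = (\<Sum>l=-max_bucket..max_bucket. g (l, True) + g (l, False))"
    using assms by (intro sum.mono_neutral_left) auto
  finally show ?thesis .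
qed

section \<open>Preservation of \<open>good\<close> by one round of branching and merging\<close>

context
  fixes m :: nat and A B :: "int \<Rightarrow> int" and L :: int
  assumes m: "m < n" and good: "good (Suc m) A B" and L: "0 \<le> L" "L \<le> max_bucket"
    and supp: "\<forall>l. L < \<bar>l\<bar> \<longrightarrow> A l = 0 \<and> B l = 0"
begin

text \<open>The two branch weights of coordinate \<open>m\<close> add up to
  \<open>pd m * qd m\<close>, which is the factor from \<open>den (Suc m)\<close> to
  \<open>den m\<close>.\<close>

lemma sum_fst_branch: "(\<Sum>x\<in>{-L..L} \<times> UNIV. fst (branch m A B x)) = den m"
proof -
  have "(\<Sum>x\<in>{-L..L} \<times> UNIV. fst (branch m A B x)) =
      (\<Sum>l=-max_bucket..max_bucket. fst (branch m A B (l, True)) + fst (branch m A B (l, False)))"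
    by (rule sum_branches) (use L supp in \<open>auto simp: branch_def\<close>)
  also have "\<dots> = (\<Sum>l=-max_bucket..max_bucket. pd m * qd m * A l)"
    by (intro sum.cong) (auto simp: branch_def wP_def algebra_simps)
  also have "\<dots> = den m"
    using good m by (simp add: good_def den_Suc flip: sum_distrib_left)
  finally show ?thesis .
qed

lemma sum_snd_branch: "(\<Sum>x\<in>{-L..L} \<times> UNIV. snd (branch m A B x)) = den m"
proof -
  have "(\<Sum>x\<in>{-L..L} \<times> UNIV. snd (branch m A B x)) =
      (\<Sum>l=-max_bucket..max_bucket. snd (branch m A B (l, True)) + snd (branch m A B (l, False)))"
    by (rule sum_branches) (use L supp in \<open>auto simp: branch_def\<close>)
  also have "\<dots> = (\<Sum>l=-max_bucket..max_bucket. pd m * qd m * B l)"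
    by (intro sum.cong) (auto simp: branch_def wQ_def algebra_simps)
  also have "\<dots> = den m"
    using good m by (simp add: good_def den_Suc flip: sum_distrib_left)
  finally show ?thesis .
qed

lemma branch_nonneg: "0 \<le> fst (branch m A B x)" "0 \<le> snd (branch m A B x)"
  using good w_nonneg by (auto simp: branch_def good_def split: prod.split)

lemma branch_le:
  assumes "x \<in> {-L..L} \<times> UNIV"
  shows "fst (branch m A B x) \<le> den m" "snd (branch m A B x) \<le> den m"
proof -
  show "fst (branch m A B x) \<le> den m"
    unfolding sum_fst_branch[symmetric] by (intro member_le_sum assms branch_nonneg) simp
  show "snd (branch m A B x) \<le> den m"
    unfolding sum_snd_branch[symmetric] by (intro member_le_sum assms branch_nonneg) simp
qed

lemma merged_nonneg: "0 \<le> merged fst m A B I l" "0 \<le> merged snd m A B I l"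
  unfolding merged_def by (intro sum_nonneg branch_nonneg)+

lemma merged_le:
  assumes "I \<subseteq> {-L..L} \<times> UNIV"
  shows "merged fst m A B I l \<le> den m" "merged snd m A B I l \<le> den m"
proof -
  show "merged fst m A B I l \<le> den m"
    unfolding merged_def sum_fst_branch[symmetric]
    using assms by (intro sum_mono2 branch_nonneg) auto
  show "merged snd m A B I l \<le> den m"
    unfolding merged_def sum_snd_branch[symmetric]
    using assms by (intro sum_mono2 branch_nonneg) auto
qed

lemma abs_bucket_branch_le:
  assumes "x \<in> {-L..L} \<times> UNIV"
  shows "\<bar>case_prod (bucket M) (branch m A B x)\<bar> \<le> max_bucket"
proof -
  have "\<bar>bucket M (fst (branch m A B x)) (snd (branch m A B x))\<bar> \<le> 1 + int (M * Suc S)"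
    using branch_le[OF assms] branch_nonneg[of x] den_le[of m]
    by (intro abs_bucket_le M) auto
  then show ?thesis
    by (simp only: max_bucket_def case_prod_beta)
qed

text \<open>Branching alone is exact up to the scaling by \<open>pd m * qd m\<close>. The merge that
  follows never increases the weight and costs at most one further factor
  \<open>1 - 1 / M\<close>.\<close>

lemma good_merged:
  "good m (merged fst m A B ({-L..L} \<times> UNIV)) (merged snd m A B ({-L..L} \<times> UNIV))"
proof -
  let ?I = "{-L..L} \<times> (UNIV :: bool set)" and ?T = "{-max_bucket..max_bucket}"
  let ?v = "branch m A B" and ?c = "\<lambda>x. case_prod (bucket M) (branch m A B x)"
  have fin: "finite ?I" "finite ?T"
    by simp_all
  have sub: "?c ` ?I \<subseteq> ?T"
  proof (rule image_subsetI)
    fix x assume "x \<in> ?I"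
    from abs_bucket_branch_le[OF this] show "?c x \<in> ?T"
      by (simp only: atLeastAtMost_iff) linarith
  qed
  have grp: "(\<Sum>l\<in>?T. merged f m A B ?I l) = (\<Sum>x\<in>?I. f (?v x))" for f :: "int \<times> int \<Rightarrow> int"
    unfolding merged_def by (rule sum.group[OF fin sub])
  define T0 where "T0 = (\<Sum>x\<in>?I. l1_dist P Q m (fst (?v x)) (snd (?v x)))"
  have near: "real M * \<bar>(real_of_int (fst (?v x)) - snd (?v x)) * (real_of_int (fst (?v y)) + snd (?v y)) -
      (real_of_int (fst (?v y)) - snd (?v y)) * (real_of_int (fst (?v x)) + snd (?v x))\<bar>
      \<le> \<bar>real_of_int (fst (?v x)) - snd (?v x)\<bar> * (real_of_int (fst (?v y)) + snd (?v y))"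
    if "?c x = ?c y" for x y
  proof -
    have "int M * \<bar>(fst (?v x) - snd (?v x)) * (fst (?v y) + snd (?v y)) -
      (fst (?v y) - snd (?v y)) * (fst (?v x) + snd (?v x))\<bar>
      \<le> \<bar>fst (?v x) - snd (?v x)\<bar> * (fst (?v y) + snd (?v y))"
      using that by (intro bucket_near M branch_nonneg) (simp add: case_prod_beta)
    then have "real_of_int (int M * \<bar>(fst (?v x) - snd (?v x)) * (fst (?v y) + snd (?v y)) -
      (fst (?v y) - snd (?v y)) * (fst (?v x) + snd (?v x))\<bar>)
      \<le> real_of_int (\<bar>fst (?v x) - snd (?v x)\<bar> * (fst (?v y) + snd (?v y)))"
      by (simp only: of_int_le_iff)
    then show ?thesis by simp
  qed
  have w: "weight m (merged fst m A B ?I) (merged snd m A B ?I) =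
     (\<Sum>l\<in>?T. l1_dist P Q m (\<Sum>x | x \<in> ?I \<and> ?c x = l. real_of_int (fst (?v x)))
        (\<Sum>x | x \<in> ?I \<and> ?c x = l. real_of_int (snd (?v x))))"
    by (simp add: weight_def merged_def)
  have nn: "0 \<le> real_of_int (fst (?v x))" "0 \<le> real_of_int (snd (?v x))" for x
    using branch_nonneg by simp_all
  note merge = l1_dist_merge[of P Q ?I ?T ?c "real M" "\<lambda>x. real_of_int (fst (?v x))"
      "\<lambda>x. real_of_int (snd (?v x))" m, OF P Q fin sub _ nn near, folded w T0_def]
  have up: "weight m (merged fst m A B ?I) (merged snd m A B ?I) \<le> T0"
    and low: "(1 - 1 / real M) * T0 \<le> weight m (merged fst m A B ?I) (merged snd m A B ?I)"
    using merge M by simp_all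
  \<comment> \<open>Before merging, the branches are just the recursion equation of
    \<open>l1_dist\<close>, with the scaling pulled out by homogeneity.\<close>
  have T0: "T0 = real_of_int (pd m * qd m) * weight (Suc m) A B"
  proof -
    have pos: "(0::real) < pd m" "(0::real) < qd m"
      using p(3)[of m] q(3)[of m] by simp_all
    have "T0 = (\<Sum>l\<in>?T. l1_dist P Q m (fst (?v (l, True))) (snd (?v (l, True))) +
        l1_dist P Q m (fst (?v (l, False))) (snd (?v (l, False))))"
      unfolding T0_def
      by (rule sum_branches) (use L supp in \<open>auto simp: branch_def l1_dist_zero\<close>)
    also have "\<dots> = (\<Sum>l\<in>?T. real_of_int (pd m * qd m) * l1_dist P Q (Suc m) (A l) (B l))"
    proof (intro sum.cong refl)
      fix l
      have "l1_dist P Q m (fst (?v (l, c))) (snd (?v (l, c))) = real_of_int (pd m * qd m) *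
          l1_dist P Q m (A l * (if c then P m else 1 - P m)) (B l * (if c then Q m else 1 - Q m))" for c
      proof -
        have "real_of_int (fst (?v (l, c))) = real_of_int (pd m * qd m) * (A l * (if c then P m else 1 - P m))"
          "real_of_int (snd (?v (l, c))) = real_of_int (pd m * qd m) * (B l * (if c then Q m else 1 - Q m))"
          using pos by (auto simp: branch_def wP_def wQ_def P_def Q_def field_simps)
        then show ?thesis
          using pos by (simp only:) (intro l1_dist_scale, simp)
      qed
      from this[of True] this[of False]
      show "l1_dist P Q m (fst (?v (l, True))) (snd (?v (l, True))) +
        l1_dist P Q m (fst (?v (l, False))) (snd (?v (l, False))) =
        real_of_int (pd m * qd m) * l1_dist P Q (Suc m) (A l) (B l)"
        by (simp only: l1_dist.simps distrib_left if_True if_False)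
    qed
    finally show ?thesis
      by (simp add: weight_def sum_distrib_left)
  qed
  have D: "real_of_int (den m) = real_of_int (pd m * qd m) * den (Suc m)"
    using den_Suc[OF m] by simp
  have pos: "0 < real_of_int (pd m * qd m)"
    using p(3)[of m] q(3)[of m] by simp
  have g: "weight (Suc m) A B \<le> l1_dist P Q n 1 1 * den (Suc m)"
    "(1 - 1 / M) ^ (n - Suc m) * (l1_dist P Q n 1 1 * den (Suc m)) \<le> weight (Suc m) A B"
    using good by (simp_all add: good_def)
  have "T0 \<le> l1_dist P Q n 1 1 * den m"
    unfolding T0 D using mult_left_mono[OF g(1), of "real_of_int (pd m * qd m)"] pos
    by (simp add: mult_ac)
  moreover have "(1 - 1 / M) ^ (n - m) * (l1_dist P Q n 1 1 * den m) \<le> (1 - 1 / M) * T0"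
  proof -
    have "n - m = Suc (n - Suc m)" using m by simp
    then have "(1 - 1 / M) ^ (n - m) * (l1_dist P Q n 1 1 * den m) =
      (1 - 1 / M) * (real_of_int (pd m * qd m) * ((1 - 1 / M) ^ (n - Suc m) * (l1_dist P Q n 1 1 * den (Suc m))))"
      unfolding D by (simp only: power_Suc mult_ac)
    also have "\<dots> \<le> (1 - 1 / M) * T0"
      unfolding T0 using g(2) pos M by (intro mult_left_mono) auto
    finally show ?thesis .
  qed
  ultimately show ?thesis
    using up low by (auto simp: good_def merged_nonneg grp sum_fst_branch sum_snd_branch)
qed

end

end

subsection \<open>The program\<close>

lemma put_apply: "put s x i z y = (if y = x then (s x)(i := z) else s y)"
  by (simp add: put_def)

definition block :: "com list \<Rightarrow> com" where
  "block cs = foldr Seq cs Skip"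

lemma wp_Skip: "R s \<Longrightarrow> wp B Z Skip R s"
  unfolding wp_def using bit_length_pos[of Z] exec.Skip[of s]
  by (intro impI exI[of _ s] exI[of _ 1]) (simp add: Suc_le_eq)

lemma wp_block_Nil: "R s \<Longrightarrow> wp B Z (block []) R s"
  by (simp add: block_def wp_Skip)

lemma wp_block_Cons: "wp B Z c (wp B Z (block cs) R) s \<Longrightarrow> wp B Z (block (c # cs)) R s"
  by (simp add: block_def wp_Seq)

text \<open>
  Arrays 1 and 2 hold the answer, where 2 serves as common denominator of all weights during the
  sweep; 3 is \<open>M\<close>.  Bucket \<open>l\<close> holds the vector of cells \<open>l\<close> of 4 and 5, and the next round's
  buckets are built up in 6 and 7.  8 counts the remaining coordinates, 9 and 10 are loop variable
  and bound, and 11 bounds the bucket indices in use.  The vector in 12 and 13 is inserted with the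
  scratch variables 14 to 17.
\<close>

definition search :: com where
  "search = While (Op Mul (Op Less (Const 0) (Var 14)) (Op Less (Var 14) (Var 15)))
     (block
       [Assign 14 (Op Mul (Var 14) (Op Add (Var 3) (Const 1))),
        Assign 15 (Op Mul (Var 15) (Var 3)),
        Assign 17 (Op Add (Var 17) (Const 1))])"

text \<open>
  A vector with \<open>a = b\<close> leaves the search at once and then gets index 0 from its sign.
\<close>

definition ins :: com where
  "ins = block
     [Assign 14 (Op Sub (Var 12) (Var 13)),
      Assign 15 (Op Add (Var 12) (Var 13)),
      Assign 16 (Op Sub (Op Less (Const 0) (Var 14)) (Op Less (Var 14) (Const 0))),
      Assign 14 (Op Mul (Var 16) (Var 14)),
      Assign 17 (Const 1),
      search,
      Assign 11 (Op Add (Var 11) (Op Mul (Op Less (Var 11) (Var 17)) (Op Sub (Var 17) (Var 11)))),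
      Assign 17 (Op Mul (Var 16) (Var 17)),
      Write 6 (Var 17) (Op Add (Read 6 (Var 17)) (Var 12)),
      Write 7 (Var 17) (Op Add (Read 7 (Var 17)) (Var 13))]"

text \<open>After \<open>k\<close> steps the cells 14 and 15 hold \<open>x * (M + 1) ^ k\<close> and
  \<open>y * M ^ k\<close>, so the loop stops at the least \<open>k\<close> that passes the test
  defining \<open>level\<close>. The bound on that level limits both the iterations and the size of
  the two products.\<close>

lemma wp_search:
  assumes st: "s 14 0 = x" "s 15 0 = y" "s 17 0 = 1" "s 3 0 = int M"
    and M: "0 < M" and xy: "0 \<le> x" "x \<le> y" "y \<le> 2 ^ t"
    and B: "M * t \<le> B" and Z: "2 ^ t * (int M + 1) ^ (M * t) \<le> Z" "1 + int (M * t) \<le> Z"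
    and R: "\<And>s'. (\<And>v. v \<notin> {14, 15, 17} \<Longrightarrow> s' v = s v) \<Longrightarrow>
      s' 17 0 = (if x = 0 then 1 else 1 + int (level M x y)) \<Longrightarrow> R s'"
  shows "wp B Z search R s"
proof -
  have lev: "level M x y \<le> M * t" if "0 < x"
    using that xy by (intro level_le M) auto
  define I where "I s' \<longleftrightarrow> (\<forall>v. v \<notin> {14, 15, 17} \<longrightarrow> s' v = s v) \<and>
    (\<exists>k. s' 14 0 = x * (int M + 1) ^ k \<and> s' 15 0 = y * int M ^ k \<and> s' 17 0 = 1 + int k \<and>
      (if x = 0 then k = 0 else k \<le> level M x y))" for s'
  show ?thesis
    unfolding search_def
  proof (rule wp_While[where I = I and \<mu> = "\<lambda>s'. nat (1 + int (M * t) - s' 17 0)"])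
    show "I s"
      unfolding I_def using st by (intro conjI allI impI exI[of _ 0]) auto
    show "nat (1 + int (M * t) - s 17 0) \<le> B"
      using st B by (simp add: nat_mult_distrib)
  next
    fix s' assume "I s'" "eval_expr s' (Op Mul (Op Less (Const 0) (Var 14)) (Op Less (Var 14) (Var 15))) \<noteq> 0"
    then obtain k where fr: "\<And>v. v \<notin> {14, 15, 17} \<Longrightarrow> s' v = s v"
      and k: "s' 14 0 = x * (int M + 1) ^ k" "s' 15 0 = y * int M ^ k" "s' 17 0 = 1 + int k"
      and k': "if x = 0 then k = 0 else k \<le> level M x y"
      and pos: "0 < s' 14 0" and lt: "s' 14 0 < s' 15 0"
      unfolding I_def by (auto split: if_splits)
    have x: "0 < x"
      using pos k(1) xy(1) by (cases "x = 0") auto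
    \<comment> \<open>The guard contradicts \<open>level_works\<close> at the level itself, so the
      step about to be made does not overshoot it. This bounds the new cell contents.\<close>
    have "k \<noteq> level M x y"
      using level_works[OF M, of x y] lt k x by auto
    with k' x have kl: "Suc k \<le> level M x y" by simp
    then have kt: "Suc k \<le> M * t" using lev[OF x] by simp
    have pw: "(int M + 1) ^ Suc k \<le> (int M + 1) ^ (M * t)"
      by (rule power_increasing[OF kt]) simp
    have "x * (int M + 1) ^ Suc k \<le> 2 ^ t * (int M + 1) ^ (M * t)"
      by (rule mult_mono) (use pw xy in auto)
    then have bx: "x * ((int M + 1) * (int M + 1) ^ k) \<le> Z" using Z by simp
    have "int M ^ Suc k \<le> (int M + 1) ^ Suc k"
      by (rule power_mono) simp_all
    then have "int M ^ Suc k \<le> (int M + 1) ^ (M * t)"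
      using pw by linarith
    then have "y * int M ^ Suc k \<le> 2 ^ t * (int M + 1) ^ (M * t)"
      by (intro mult_mono) (use xy in auto)
    then have bY: "y * (int M * int M ^ k) \<le> Z" using Z by simp
    have bk: "2 + int k \<le> Z" using kt Z(2) by linarith
    have s3: "s' 3 0 = int M" using fr[of 3] st by simp
    define s'' where "s'' = put (put (put s' 14 0 (x * (int M + 1) ^ Suc k)) 15 0 (y * int M ^ Suc k)) 17 0 (1 + int (Suc k))"
    have I: "I s''"
      unfolding I_def
    proof (intro conjI exI[of _ "Suc k"])
      show "\<forall>v. v \<notin> {14, 15, 17} \<longrightarrow> s'' v = s v"
        using fr by (simp add: s''_def put_apply)
      show "if x = 0 then Suc k = 0 else Suc k \<le> level M x y"
        using x kl by simp
    qed (simp_all add: s''_def put_apply)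
    have kt': "1 + int k \<le> int (M * t)"
      using kt unfolding of_nat_le_iff[symmetric, where 'a = int] by simp
    have mu: "nat (1 + int (M * t) - s'' 17 0) < nat (1 + int (M * t) - s' 17 0)"
      using kt' k(3) by (simp add: s''_def put_apply)
    have nn: "0 \<le> y" using xy by simp
    show "wp B Z (block
       [Assign 14 (Op Mul (Var 14) (Op Add (Var 3) (Const 1))),
        Assign 15 (Op Mul (Var 15) (Var 3)),
        Assign 17 (Op Add (Var 17) (Const 1))])
      (\<lambda>s''. I s'' \<and> nat (1 + int (M * t) - s'' 17 0) < nat (1 + int (M * t) - s' 17 0)) s'"
    by (intro wp_block_Cons wp_Write wp_block_Nil) (use bx bY bk x nn s3 k I mu in \<open>simp_all add: put_apply s''_def abs_mult mult_ac\<close>)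
  next
    fix s' assume I: "I s'" and "eval_expr s' (Op Mul (Op Less (Const 0) (Var 14)) (Op Less (Var 14) (Var 15))) = 0"
    then obtain k where fr: "\<And>v. v \<notin> {14, 15, 17} \<Longrightarrow> s' v = s v"
      and k: "s' 14 0 = x * (int M + 1) ^ k" "s' 15 0 = y * int M ^ k" "s' 17 0 = 1 + int k"
      and k': "if x = 0 then k = 0 else k \<le> level M x y"
      and ex: "\<not> 0 < s' 14 0 \<or> \<not> s' 14 0 < s' 15 0"
      unfolding I_def by (auto split: if_splits)
    have "s' 17 0 = (if x = 0 then 1 else 1 + int (level M x y))"
    proof (cases "x = 0")
      case False
      then have "0 < s' 14 0"
        using k(1) xy by simp
      with ex have "y * int M ^ k \<le> x * (int M + 1) ^ k"
        using k by simp
      then have "level M x y \<le> k"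
        unfolding level_def by (rule Least_le)
      with k' False k(3) show ?thesis by simp
    qed (use k k' in simp)
    with fr show "R s'" by (rule R)
  qed
qed

context sweep
begin

text \<open>The bound \<open>wp_search\<close> needs with \<open>t = Suc S\<close>; it dominates all
  other numbers that are stored.\<close>

definition Zmax :: int where
  "Zmax = 2 ^ Suc S * (int M + 1) ^ (M * Suc S)"

text \<open>A pass over all buckets takes at most \<open>2 * max_bucket + 1\<close> iterations,
  which are the first two summands. The search is shorter, and \<open>n\<close> covers the outer
  loop.\<close>

definition Bmax :: nat where
  "Bmax = 2 * (M * Suc S) + 3 + n"

lemma two_power_le_Zmax: "2 ^ Suc S \<le> Zmax"
  using mult_left_mono[of 1 "(int M + 1) ^ (M * Suc S)" "2 ^ Suc S"] by (simp add: Zmax_def)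

text \<open>The extra 1 is for the loop bound, one past the last bucket.\<close>

lemma max_bucket_less_Zmax: "max_bucket + 1 \<le> Zmax"
proof -
  have "int (M * Suc S) < 2 ^ (M * Suc S)"
    by (rule of_nat_less_two_power)
  also have "\<dots> \<le> (int M + 1) ^ (M * Suc S)"
    using M by (intro power_mono) auto
  finally have "max_bucket \<le> (int M + 1) ^ (M * Suc S)"
    by (simp add: max_bucket_def)
  moreover have "2 * (int M + 1) ^ (M * Suc S) \<le> Zmax"
    unfolding Zmax_def by (intro mult_right_mono) auto
  ultimately show ?thesis
    using max_bucket_pos by linarith
qed

lemma M_less_max_bucket: "int M < max_bucket"
  unfolding max_bucket_def of_nat_mult of_nat_Suc distrib_left
  using mult_nonneg_nonneg[OF of_nat_0_le_iff[of M] of_nat_0_le_iff[of S], where 'a1 = int]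
  by linarith

text \<open>Cell 11 is raised to the unsigned index \<open>J\<close>. For \<open>a = b\<close> this
  is 1 although the vector goes to bucket 0, so the conclusion asserts only that cell 11 bounds
  \<open>\<bar>l\<bar>\<close>. The bounds on the two updated cells are hypotheses because they
  depend on the total mass, which only the surrounding invariant knows.\<close>

lemma wp_ins:
  assumes ab: "s 12 0 = a" "s 13 0 = b" "0 \<le> a" "0 \<le> b" "a \<le> 2 ^ S" "b \<le> 2 ^ S"
    and st: "s 3 0 = int M" "0 \<le> s 11 0" "s 11 0 \<le> max_bucket"
    and l: "l = bucket M a b"
    and bd: "\<bar>s 6 l + a\<bar> \<le> Zmax" "\<bar>s 7 l + b\<bar> \<le> Zmax"
    and R: "\<And>s'. (\<And>x. x \<notin> {6, 7, 11, 14, 15, 16, 17} \<Longrightarrow> s' x = s x) \<Longrightarrow>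
      s' 6 = (s 6)(l := s 6 l + a) \<Longrightarrow> s' 7 = (s 7)(l := s 7 l + b) \<Longrightarrow>
      s 11 0 \<le> s' 11 0 \<Longrightarrow> \<bar>l\<bar> \<le> s' 11 0 \<Longrightarrow> s' 11 0 \<le> max_bucket \<Longrightarrow> R s'"
  shows "wp Bmax Zmax ins R s"
proof -
  let ?x = "\<bar>a - b\<bar>" and ?y = "a + b"
  define J where "J = (if ?x = 0 then 1 else 1 + int (level M ?x ?y))"
  have y: "?y \<le> 2 ^ Suc S" and xy: "?x \<le> ?y"
    using ab by auto
  have Jm: "1 \<le> J" "J \<le> max_bucket"
  proof -
    have "level M ?x ?y \<le> M * Suc S" if "?x \<noteq> 0"
      using that y by (intro level_le M) auto
    then show "J \<le> max_bucket"
      using max_bucket_pos unfolding J_def max_bucket_def of_nat_le_iff[symmetric, where 'a = int] by auto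
  qed (simp add: J_def)
  have lJ: "l = sgn (a - b) * J"
    by (simp add: l bucket_def J_def)
  have labs: "\<bar>l\<bar> \<le> J"
    using Jm by (simp add: lJ abs_mult abs_sgn_eq)
  have sgn: "(if 0 < a - b then 1 else 0) - (if a - b < 0 then 1 else 0) = sgn (a - b)"
    by (simp add: sgn_if)
  have sg: "sgn (a - b) * (a - b) = \<bar>a - b\<bar>"
    by (simp add: sgn_if)
  have bdZ: "\<bar>a - b\<bar> \<le> Zmax" "\<bar>a + b\<bar> \<le> Zmax" "max_bucket \<le> Zmax" "1 \<le> Zmax" "\<bar>sgn (a - b)\<bar> \<le> Zmax"
    using xy y ab two_power_le_Zmax max_bucket_less_Zmax max_bucket_pos by (auto simp: sgn_if)
  show ?thesis
    unfolding ins_def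
  proof (intro wp_block_Cons wp_Write, goal_cases)
    case 6
    show ?case
    proof (rule wp_search[where M = M and x = ?x and y = ?y and t = "Suc S"], goal_cases)
      case (12 s1)
      have fr: "s1 v = s v" if "v \<notin> {14, 15, 16, 17}" for v
        using 12(1)[of v] that by (simp add: put_apply)
      have s16: "s1 16 0 = sgn (a - b)"
        using 12(1)[of 16] ab sgn by (simp add: put_apply)
      have s17: "s1 17 0 = J"
        using 12(2) by (simp only: J_def)
      have vals: "s1 12 0 = a" "s1 13 0 = b" "s1 11 0 = s 11 0" "s1 6 = s 6" "s1 7 = s 7"
        using ab by (simp_all add: fr)
      \<comment> \<open>The program takes a maximum without branching: \<open>Less\<close> supplies
        a factor 0 or 1.\<close>
      have mx: "s 11 0 + (if s 11 0 < J then 1 else 0) * (J - s 11 0) = max (s 11 0) J"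
        by simp
      show ?case
      proof (intro wp_block_Cons wp_Write wp_block_Nil, goal_cases)
        case 5
        show ?case
          by (rule R) (use st ab labs Jm in \<open>auto simp: put_apply fr s16 s17 vals mx lJ[symmetric]\<close>)
      qed (use st bd bdZ Jm labs in \<open>auto simp: put_apply s16 s17 vals mx lJ[symmetric] max_def\<close>)
    qed (use sg ab st M xy y bdZ sgn in \<open>auto simp: put_apply Bmax_def Zmax_def max_bucket_def sg\<close>)
  qed (use ab bdZ sgn sg in \<open>simp_all add: put_apply\<close>)
qed

end

text \<open>Array 0 starts with \<open>n\<close> and the two fractions \<epsilon> and \<delta>, so
  the pairs for \<open>p\<close> begin at cell 5 and those for \<open>q\<close> at cell
  \<open>5 + 2 * n\<close>. Cell 8 supplies the current coordinate.\<close>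

definition input :: "expr \<Rightarrow> expr" where
  "input e = Read 0 (Op Add e (Op Mul (Const 2) (Var 8)))"

definition in_pn :: expr where "in_pn = input (Const 5)"
definition in_pd :: expr where "in_pd = input (Const 6)"
definition in_qn :: expr where "in_qn = input (Op Add (Const 5) (Op Mul (Const 2) (Var 0)))"
definition in_qd :: expr where "in_qd = input (Op Add (Const 6) (Op Mul (Const 2) (Var 0)))"

definition ins_branch :: "expr \<Rightarrow> expr \<Rightarrow> com" where
  "ins_branch e f = block
     [Assign 12 (Op Mul (Read 4 (Var 9)) e),
      Assign 13 (Op Mul (Read 5 (Var 9)) f),
      ins]"

definition expand :: com where
  "expand = For 9 10 (block
     [ins_branch (Op Mul in_pn in_qd) (Op Mul in_qn in_pd),
      ins_branch (Op Mul (Op Sub in_pd in_pn) in_qd) (Op Mul (Op Sub in_qd in_qn) in_pd)])"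

definition copy :: com where
  "copy = For 9 10 (block
     [Write 4 (Var 9) (Read 6 (Var 9)),
      Write 5 (Var 9) (Read 7 (Var 9)),
      Write 6 (Var 9) (Const 0),
      Write 7 (Var 9) (Const 0)])"

text \<open>Decrementing cell 8 at the start makes it the coordinate to be expanded. The loop bounds
  are loaded again before \<open>copy\<close> because \<open>expand\<close> may have raised cell
  11.\<close>

definition sweep_round :: com where
  "sweep_round = block
     [Assign 8 (Op Sub (Var 8) (Const 1)),
      Assign 2 (Op Mul (Var 2) (Op Mul in_pd in_qd)),
      Assign 9 (Op Sub (Const 0) (Var 11)),
      Assign 10 (Op Add (Var 11) (Const 1)),
      expand,
      Assign 9 (Op Sub (Const 0) (Var 11)),
      Assign 10 (Op Add (Var 11) (Const 1)),
      copy]"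

definition accumulate :: com where
  "accumulate = For 9 10 (Assign 1 (Op Add (Var 1)
     (Op Mul (Op Sub (Read 4 (Var 9)) (Read 5 (Var 9)))
       (Op Sub (Op Less (Read 5 (Var 9)) (Read 4 (Var 9))) (Op Less (Read 4 (Var 9)) (Read 5 (Var 9)))))))"

text \<open>The first assignment computes the floor of \<open>n / \<epsilon>\<close> plus 1, which
  is positive and at least \<open>n / \<epsilon>\<close>. The final doubling of the denominator is
  the factor 1/2 in the total variation distance.\<close>

definition algorithm :: com where
  "algorithm = block
     [Assign 3 (Op Add (Op Div (Op Mul (Var 0) (Read 0 (Const 2))) (Read 0 (Const 1))) (Const 1)),
      Assign 2 (Const 1),
      Assign 4 (Const 1),
      Assign 5 (Const 1),
      Assign 8 (Var 0),
      While (Var 8) sweep_round,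
      Assign 9 (Op Sub (Const 0) (Var 11)),
      Assign 10 (Op Add (Var 11) (Const 1)),
      accumulate,
      Assign 2 (Op Mul (Const 2) (Var 2))]"

section \<open>Invariants of the sweep and of its inner loops\<close>

context sweep
begin

definition holds_input :: "store \<Rightarrow> bool" where
  "holds_input s \<longleftrightarrow> s 0 0 = int n \<and> (\<forall>i<n.
     s 0 (5 + 2 * int i) = pn i \<and> s 0 (6 + 2 * int i) = pd i \<and>
     s 0 (5 + 2 * int n + 2 * int i) = qn i \<and> s 0 (6 + 2 * int n + 2 * int i) = qd i)"

definition scalars :: "nat \<Rightarrow> store \<Rightarrow> bool" where
  "scalars m s \<longleftrightarrow> holds_input s \<and> s 1 0 = 0 \<and> s 2 0 = den m \<and> s 3 0 = int M \<and> s 8 0 = int m \<and>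
     0 \<le> s 11 0 \<and> s 11 0 \<le> max_bucket"

lemma scalars_put: "x \<notin> {0, 1, 2, 3, 8, 11} \<Longrightarrow> scalars m (put s x i z) = scalars m s"
  by (auto simp: scalars_def holds_input_def put_apply)

lemma scalars_cong:
  "(\<And>x. x \<in> {0, 1, 2, 3, 8} \<Longrightarrow> s x = s' x) \<Longrightarrow> 0 \<le> s' 11 0 \<Longrightarrow> s' 11 0 \<le> max_bucket \<Longrightarrow>
    scalars m s \<Longrightarrow> scalars m s'"
  by (simp add: scalars_def holds_input_def)

lemma eval_inputs:
  assumes "holds_input s" "s 8 0 = int m" "m < n"
  shows "eval_expr s in_pn = pn m" "eval_expr s in_pd = pd m"
    "eval_expr s in_qn = qn m" "eval_expr s in_qd = qd m"
  using assms by (auto simp: in_pn_def in_pd_def in_qn_def in_qd_def input_def holds_input_def)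

lemma abs_le_Zmax: "0 \<le> x \<Longrightarrow> x \<le> den m \<Longrightarrow> \<bar>x\<bar> \<le> Zmax"
  using two_power_le_Zmax den_le[of m] by simp

definition inv :: "nat \<Rightarrow> store \<Rightarrow> bool" where
  "inv m s \<longleftrightarrow> scalars m s \<and> m \<le> n \<and> s 6 = (\<lambda>_. 0) \<and> s 7 = (\<lambda>_. 0) \<and>
     (\<forall>l. s 11 0 < \<bar>l\<bar> \<longrightarrow> s 4 l = 0 \<and> s 5 l = 0) \<and> good m (s 4) (s 5)"

lemma merged_empty: "merged f m A B {} = (\<lambda>_. 0)"
  by (simp add: merged_def fun_eq_iff)

text \<open>One more branch changes a single bucket, which is precisely the effect of the two array
  updates in \<open>ins\<close>.\<close>

lemma merged_insert:
  fixes m :: nat and A B :: "int \<Rightarrow> int"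
  assumes "finite I" "x \<notin> I"
  defines "l \<equiv> case_prod (bucket M) (branch m A B x)"
  shows "merged f m A B (insert x I) =
    (merged f m A B I)(l := merged f m A B I l + f (branch m A B x))"
proof
  fix k
  have "{y. y \<in> insert x I \<and> case_prod (bucket M) (branch m A B y) = k} =
    (if k = l then insert x else id) {y. y \<in> I \<and> case_prod (bucket M) (branch m A B y) = k}"
    by (auto simp: l_def)
  then show "merged f m A B (insert x I) k =
    ((merged f m A B I)(l := merged f m A B I l + f (branch m A B x))) k"
    using assms(1,2) by (simp add: merged_def add.commute)
qed

context
  fixes m :: nat and A B :: "int \<Rightarrow> int" and L :: int
  assumes m: "m < n" and good: "good (Suc m) A B" and L: "0 \<le> L" "L \<le> max_bucket"
    and supp: "\<forall>l. L < \<bar>l\<bar> \<longrightarrow> A l = 0 \<and> B l = 0"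
begin

lemmas prem = m good L supp

definition expanding :: "(int \<times> bool) set \<Rightarrow> store \<Rightarrow> bool" where
  "expanding I s \<longleftrightarrow> scalars m s \<and> s 4 = A \<and> s 5 = B \<and>
     s 6 = merged fst m A B I \<and> s 7 = merged snd m A B I \<and> L \<le> s 11 0 \<and>
     (\<forall>l. s 11 0 < \<bar>l\<bar> \<longrightarrow> s 6 l = 0 \<and> s 7 l = 0)"

lemma expanding_put: "x \<notin> {0, 1, 2, 3, 4, 5, 6, 7, 8, 11} \<Longrightarrow> expanding I (put s x i z) = expanding I s"
  by (simp add: expanding_def scalars_put) (simp add: put_apply)

text \<open>The weight expressions are assumed correct in all stores satisfying
  \<open>scalars\<close>, since the second is evaluated after the first product has been written.
  Partially built buckets are parts of the total mass, hence at most \<open>den m\<close>, and so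
  the updates stay below \<open>Zmax\<close>.\<close>

lemma wp_ins_branch:
  assumes ex: "expanding I s" and I: "insert (j, c) I \<subseteq> {-L..L} \<times> UNIV" "(j, c) \<notin> I" and j: "s 9 0 = j"
    and e: "\<And>s'. scalars m s' \<Longrightarrow> eval_expr s' e = wP m c" "\<And>s'. scalars m s' \<Longrightarrow> eval_expr s' f = wQ m c"
  shows "wp Bmax Zmax (ins_branch e f)
    (\<lambda>s'. expanding (insert (j, c) I) s' \<and> s' 9 = s 9 \<and> s' 10 = s 10) s"
proof -
  define x where "x = (j, c)"
  note x = I[folded x_def]
  have fin: "finite I"
    using I(1) by (rule finite_subset[rotated, OF finite_subset]) auto
  let ?a = "fst (branch m A B x)" and ?b = "snd (branch m A B x)"
  have ab: "A j * wP m c = ?a" "B j * wQ m c = ?b"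
    by (simp_all add: branch_def x_def)
  have nn: "0 \<le> ?a" "0 \<le> ?b"
    using branch_nonneg[OF prem] by blast+
  have le: "?a \<le> den m" "?b \<le> den m"
    using branch_le[OF prem, of x] x(1) by auto
  have sc: "scalars m s" "s 4 = A" "s 5 = B"
    using ex by (auto simp: expanding_def)
  let ?s = "put (put s 12 0 ?a) 13 0 ?b"
  have exs: "expanding I ?s"
    using ex by (simp add: expanding_put)
  define l where "l = bucket M ?a ?b"
  have mi: "merged g m A B (insert x I) = (merged g m A B I)(l := merged g m A B I l + g (branch m A B x))"
    for g :: "int \<times> int \<Rightarrow> int"
    using merged_insert[OF fin x(2), of g m A B] by (simp add: l_def case_prod_beta)
  have mle: "\<bar>merged g m A B I l + g (branch m A B x)\<bar> \<le> Zmax" if "g = fst \<or> g = snd" for g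
  proof -
    have "merged g m A B I l + g (branch m A B x) = merged g m A B (insert x I) l"
      by (simp add: mi)
    moreover have "0 \<le> merged g m A B (insert x I) l \<and> merged g m A B (insert x I) l \<le> den m"
      using that merged_nonneg[OF prem] merged_le[OF prem x(1)] by (elim disjE) simp_all
    ultimately show ?thesis
      using abs_le_Zmax[of _ m] by simp
  qed
  have ins: "wp Bmax Zmax ins (\<lambda>s'. expanding (insert x I) s' \<and> s' 9 = s 9 \<and> s' 10 = s 10) ?s"
  proof (rule wp_ins[where l = l])
    show "?s 12 0 = ?a" "?s 13 0 = ?b"
      by (simp_all add: put_apply)
    show "0 \<le> ?a" "0 \<le> ?b" by (rule nn)+
    show "?a \<le> 2 ^ S" "?b \<le> 2 ^ S"
      using le den_le[of m] by linarith+
    show "?s 3 0 = int M" "0 \<le> ?s 11 0" "?s 11 0 \<le> max_bucket"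
      using exs by (simp_all add: expanding_def scalars_def)
    show "\<bar>?s 6 l + ?a\<bar> \<le> Zmax" "\<bar>?s 7 l + ?b\<bar> \<le> Zmax"
      using exs mle by (simp_all add: expanding_def)
    show "l = bucket M ?a ?b" by (rule l_def)
  next
    fix s' assume fr: "\<And>x. x \<notin> {6, 7, 11, 14, 15, 16, 17} \<Longrightarrow> s' x = ?s x"
      and s6: "s' 6 = (?s 6)(l := ?s 6 l + ?a)" and s7: "s' 7 = (?s 7)(l := ?s 7 l + ?b)"
      and s11: "?s 11 0 \<le> s' 11 0" "\<bar>l\<bar> \<le> s' 11 0" "s' 11 0 \<le> max_bucket"
    have "scalars m s'"
      by (rule scalars_cong[of ?s]) (use fr s11 exs in \<open>auto simp: expanding_def scalars_def\<close>)
    moreover have "s' 4 = A" "s' 5 = B" "s' 9 = s 9" "s' 10 = s 10"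
      using sc by (simp_all add: fr put_apply)
    moreover have "s' 6 = merged fst m A B (insert x I)" "s' 7 = merged snd m A B (insert x I)"
      unfolding s6 s7 mi using exs by (simp_all add: expanding_def)
    moreover have "L \<le> s' 11 0"
      using exs s11 by (simp add: expanding_def)
    moreover have "s' 6 l' = 0 \<and> s' 7 l' = 0" if "s' 11 0 < \<bar>l'\<bar>" for l'
      using that exs s11 unfolding s6 s7 by (auto simp: expanding_def)
    ultimately show "expanding (insert x I) s' \<and> s' 9 = s 9 \<and> s' 10 = s 10"
      by (simp add: expanding_def)
  qed
  show ?thesis
    unfolding ins_branch_def x_def[symmetric]
  proof (intro wp_block_Cons wp_Write, goal_cases)
    case 1
    show ?case
      using sc j e(1)[OF sc(1)] abs_le_Zmax[OF nn(1) le(1)] by (simp add: ab)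
  next
    case 2
    show ?case
      using sc j e(2)[of "put s 12 0 _"] abs_le_Zmax[OF nn(2) le(2)]
      by (simp add: scalars_put) (simp add: put_apply ab)
  next
    case 3
    have "wp Bmax Zmax ins (wp Bmax Zmax (block []) (\<lambda>s'. expanding (insert x I) s' \<and> s' 9 = s 9 \<and> s' 10 = s 10)) ?s"
      using ins by (rule wp_mono) (rule wp_block_Nil)
    moreover have "eval_expr s (Op Mul (Read 4 (Var 9)) e) = ?a"
      using sc j e(1)[OF sc(1)] by (simp add: ab)
    moreover have "eval_expr (put s 12 0 ?a) (Op Mul (Read 5 (Var 9)) f) = ?b"
      using sc j e(2)[of "put s 12 0 ?a"] by (simp add: scalars_put) (simp add: put_apply ab)
    ultimately show ?case
      by simp
  qed
qed

lemma wp_expand: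
  assumes ex: "expanding {} s" and s: "s 9 0 = - L" "s 10 0 = L + 1"
  shows "wp Bmax Zmax expand (expanding ({-L..L} \<times> UNIV)) s"
  unfolding expand_def
proof (rule wp_For[where I = "\<lambda>j. expanding ({-L..<j} \<times> UNIV)" and h = "L + 1"])
  show "expanding ({-L..<s 9 0} \<times> UNIV) s"
    using ex s by simp
  show "nat (L + 1 - s 9 0) \<le> Bmax"
    using L s unfolding max_bucket_def Bmax_def of_nat_le_iff[symmetric, where 'a = int]
    by (simp add: nat_le_iff)
  show "\<bar>s 9 0\<bar> \<le> Zmax" "\<bar>L + 1\<bar> \<le> Zmax" "s 9 0 \<le> L + 1"
    using L s max_bucket_less_Zmax by simp_all
  show "expanding ({-L..L} \<times> UNIV) s'" if "expanding ({-L..<L + 1} \<times> UNIV) s'" for s'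
  proof -
    have "{-L..<L + 1} = {-L..L}" by auto
    with that show ?thesis by simp
  qed
next
  fix j s'
  assume j: "s 9 0 \<le> j" "j < L + 1" and s': "s' 9 0 = j" "s' 10 0 = L + 1"
    and ex': "expanding ({-L..<j} \<times> UNIV) s'"
  let ?I = "{-L..<j} \<times> (UNIV :: bool set)"
  have I: "insert (j, False) (insert (j, True) ?I) = {-L..<j + 1} \<times> UNIV"
    using j s by (auto simp: UNIV_bool)
  have ev: "eval_expr s' (Op Mul in_pn in_qd) = wP m True"
    "eval_expr s' (Op Mul in_qn in_pd) = wQ m True"
    "eval_expr s' (Op Mul (Op Sub in_pd in_pn) in_qd) = wP m False"
    "eval_expr s' (Op Mul (Op Sub in_qd in_qn) in_pd) = wQ m False" if "scalars m s'" for s'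
    using that m by (simp_all add: scalars_def eval_inputs wP_def wQ_def)
  show "wp Bmax Zmax
    (block [ins_branch (Op Mul in_pn in_qd) (Op Mul in_qn in_pd),
      ins_branch (Op Mul (Op Sub in_pd in_pn) in_qd) (Op Mul (Op Sub in_qd in_qn) in_pd)])
    (\<lambda>s''. s'' 9 0 = j \<and> s'' 10 0 = L + 1 \<and> expanding ({-L..<j + 1} \<times> UNIV) (put s'' 9 0 (j + 1))) s'"
  proof (rule wp_block_Cons, rule wp_mono[OF wp_ins_branch[where j = j and c = True, OF ex']], goal_cases)
    case (6 s1)
    then have s1: "expanding (insert (j, True) ?I) s1" "s1 9 0 = j" "s1 10 0 = L + 1"
      using s' by simp_all
    show ?case
    proof (rule wp_block_Cons, rule wp_mono[OF wp_ins_branch[where j = j and c = False, OF s1(1)]], goal_cases)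
      case (6 s2)
      then show ?case
        using s1 by (intro wp_block_Nil) (simp add: expanding_put I)
    qed (use j s s1 ev in auto)
  qed (use j s s' ev in auto)
qed (use s in simp_all)

text \<open>The equations range over all indices although only \<open>-L'..L'\<close> is visited.
  Beyond \<open>L'\<close> both old and new buckets are zero, so there nothing has to be
  moved.\<close>

definition copying :: "int \<Rightarrow> int \<Rightarrow> store \<Rightarrow> bool" where
  "copying L' j s \<longleftrightarrow> scalars m s \<and> s 11 0 = L' \<and>
     (\<forall>l. s 4 l = (if l < j then merged fst m A B ({-L..L} \<times> UNIV) l else A l)) \<and>
     (\<forall>l. s 5 l = (if l < j then merged snd m A B ({-L..L} \<times> UNIV) l else B l)) \<and>
     (\<forall>l. s 6 l = (if l < j then 0 else merged fst m A B ({-L..L} \<times> UNIV) l)) \<and>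
     (\<forall>l. s 7 l = (if l < j then 0 else merged snd m A B ({-L..L} \<times> UNIV) l))"

lemma wp_copy:
  assumes ex: "expanding ({-L..L} \<times> UNIV) s" and s: "s 9 0 = - s 11 0" "s 10 0 = s 11 0 + 1"
  shows "wp Bmax Zmax copy (inv m) s"
proof -
  let ?A = "merged fst m A B ({-L..L} \<times> UNIV)" and ?B = "merged snd m A B ({-L..L} \<times> UNIV)"
  define L' where "L' = s 11 0"
  have L': "L \<le> L'" "L' \<le> max_bucket"
    using ex by (auto simp: expanding_def scalars_def L'_def)
  have zero: "A l = 0" "B l = 0" "?A l = 0" "?B l = 0" if "L' < \<bar>l\<bar>" for l
  proof -
    show "A l = 0" "B l = 0"
      using that L' supp by auto
    show "?A l = 0" "?B l = 0"
      using that ex by (auto simp: expanding_def L'_def)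
  qed
  have bd: "\<bar>?A l\<bar> \<le> Zmax" "\<bar>?B l\<bar> \<le> Zmax" for l
    using merged_nonneg[OF prem] merged_le[OF prem] by (intro abs_le_Zmax[of _ m]; simp)+
  show ?thesis
    unfolding copy_def
  proof (rule wp_For[where I = "copying L'" and h = "L' + 1"])
    show "copying L' (s 9 0) s"
      unfolding copying_def
      using ex s zero by (auto simp: expanding_def L'_def)
    show "nat (L' + 1 - s 9 0) \<le> Bmax"
      using L L' s unfolding max_bucket_def Bmax_def of_nat_le_iff[symmetric, where 'a = int]
      by (simp add: nat_le_iff L'_def)
    show "\<bar>s 9 0\<bar> \<le> Zmax" "\<bar>L' + 1\<bar> \<le> Zmax" "s 9 0 \<le> L' + 1" "s 10 0 = L' + 1"
      using L L' s max_bucket_less_Zmax by (simp_all add: L'_def)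
    show "inv m s'" if c: "copying L' (L' + 1) s'" for s'
    proof -
      have s4: "s' 4 = ?A"
        using c zero by (auto simp: copying_def fun_eq_iff)
      have s5: "s' 5 = ?B"
        using c zero by (auto simp: copying_def fun_eq_iff)
      have s67: "s' 6 = (\<lambda>_. 0)" "s' 7 = (\<lambda>_. 0)"
        using c zero by (auto simp: copying_def fun_eq_iff)
      show ?thesis
        using good_merged[OF prem] m c zero unfolding inv_def s4 s5 s67
        by (simp add: copying_def)
    qed
  next
    fix j s'
    assume j: "s 9 0 \<le> j" "j < L' + 1" and s': "s' 9 0 = j" "s' 10 0 = L' + 1"
      and c: "copying L' j s'"
    have r: "s' 6 j = ?A j" "s' 7 j = ?B j"
      using c by (simp_all add: copying_def)
    let ?s = "put (put (put (put s' 4 j (?A j)) 5 j (?B j)) 6 j 0) 7 j 0"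
    have sc: "scalars m (put ?s 9 0 (j + 1))"
      using c by (simp add: scalars_put copying_def)
    have c': "copying L' (j + 1) (put ?s 9 0 (j + 1))"
      unfolding copying_def
      using c sc by (auto simp: copying_def put_apply)
    have Z: "0 \<le> Zmax"
      using bd(1)[of 0] by linarith
    show "wp Bmax Zmax (block
       [Write 4 (Var 9) (Read 6 (Var 9)), Write 5 (Var 9) (Read 7 (Var 9)),
        Write 6 (Var 9) (Const 0), Write 7 (Var 9) (Const 0)])
      (\<lambda>s''. s'' 9 0 = j \<and> s'' 10 0 = L' + 1 \<and> copying L' (j + 1) (put s'' 9 0 (j + 1))) s'"
    proof (intro wp_block_Cons wp_Write wp_block_Nil, goal_cases)
      case 5
      have "eval_expr s' (Var 9) = j" "eval_expr s' (Read 6 (Var 9)) = ?A j"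
        using s' r by simp_all
      moreover have "eval_expr (put s' 4 j z) (Var 9) = j" "eval_expr (put s' 4 j z) (Read 7 (Var 9)) = ?B j" for z
        using s' r by (simp_all add: put_apply)
      moreover have "eval_expr (put (put s' 4 j z) 5 j z') (Var 9) = j"
         "eval_expr (put (put s' 4 j z) 5 j z') (Const 0) = 0"
         "eval_expr (put (put (put s' 4 j z) 5 j z') 6 j z'') (Var 9) = j" for z z' z''
        using s' r by (simp_all add: put_apply)
      moreover have "?s 9 0 = j" "?s 10 0 = L' + 1"
        using s' by (simp_all add: put_apply)
      ultimately show ?case
        using c' by (simp only: eval_expr.simps(1))
    qed (use s' r bd Z in \<open>simp_all add: put_apply\<close>)
  qed simp
qed

end

lemma wp_round:
  assumes inv: "inv (Suc m) s"
  shows "wp Bmax Zmax sweep_round (inv m) s"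
proof -
  define L where "L = s 11 0"
  have m: "m < n" and sc: "scalars (Suc m) s" and good: "good (Suc m) (s 4) (s 5)"
    and L: "0 \<le> L" "L \<le> max_bucket" and supp: "\<forall>l. L < \<bar>l\<bar> \<longrightarrow> s 4 l = 0 \<and> s 5 l = 0"
    using inv by (auto simp: inv_def scalars_def L_def)
  note prem = m good L supp
  let ?s = "put (put (put (put s 8 0 (int m)) 2 0 (den m)) 9 0 (- L)) 10 0 (L + 1)"
  have inp: "holds_input (put s 8 0 (int m))"
    using sc by (simp add: scalars_def holds_input_def put_apply)
  have ev: "eval_expr (put s 8 0 (int m)) in_pd = pd m" "eval_expr (put s 8 0 (int m)) in_qd = qd m"
    using inp m by (simp_all add: eval_inputs put_apply)
  have d: "s 2 0 * (pd m * qd m) = den m"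
    using sc m by (simp add: scalars_def den_Suc)
  have sc': "scalars m ?s"
    using sc by (simp add: scalars_def holds_input_def put_apply)
  have ex: "expanding m (s 4) (s 5) L {} ?s"
    unfolding expanding_def[OF prem] using sc' inv
    by (simp add: inv_def merged_empty L_def put_apply)
  have st: "s 8 0 = int (Suc m)" "s 11 0 = L"
    using sc by (simp_all add: scalars_def L_def)
  have bd: "\<bar>int m\<bar> \<le> Zmax" "\<bar>den m\<bar> \<le> Zmax" "\<And>l. 0 \<le> l \<Longrightarrow> l \<le> max_bucket \<Longrightarrow> \<bar>- l\<bar> \<le> Zmax \<and> \<bar>l + 1\<bar> \<le> Zmax"
  proof -
    have "m \<le> S" using m S(2) by simp
    then have "int m \<le> 2 ^ S"
      using of_nat_less_two_power[of S, where 'a = int] by linarith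
    then show "\<bar>int m\<bar> \<le> Zmax"
      using two_power_le_Zmax unfolding power_Suc by linarith
    show "\<bar>den m\<bar> \<le> Zmax"
      using den_pos[of m] by (intro abs_le_Zmax) auto
    show "\<bar>- l\<bar> \<le> Zmax \<and> \<bar>l + 1\<bar> \<le> Zmax" if "0 \<le> l" "l \<le> max_bucket" for l
      using that max_bucket_less_Zmax by simp
  qed
  show ?thesis
    unfolding sweep_round_def
  proof (intro wp_block_Cons wp_Write, goal_cases)
    case 5
    have "wp Bmax Zmax expand (wp Bmax Zmax (block [Assign 9 (Op Sub (Const 0) (Var 11)),
        Assign 10 (Op Add (Var 11) (Const 1)), copy]) (inv m)) ?s"
    proof (rule wp_mono[OF wp_expand[OF prem ex]], goal_cases)
      case (3 s1)
      then have "0 \<le> s1 11 0" "s1 11 0 \<le> max_bucket"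
        by (simp_all add: expanding_def[OF prem] scalars_def)
      note bd1 = bd(3)[OF this]
      show ?case
      proof (intro wp_block_Cons wp_Write, goal_cases)
        case 3
        show ?case
          by (rule wp_mono[OF wp_copy[OF prem]])
            (use 3 \<open>expanding m (s 4) (s 5) L ({-L..L} \<times> UNIV) s1\<close> in
              \<open>simp_all add: expanding_put[OF prem] wp_block_Nil\<close>, simp_all add: put_apply)
      qed (use bd1 in \<open>simp_all add: put_apply\<close>)
    qed (simp_all add: put_apply)
    then show ?case
      using st d ev by (simp add: put_apply)
  qed (use st d ev bd L in \<open>simp_all add: put_apply\<close>)
qed

end

section \<open>Evaluating the final buckets and the whole program\<close>

context sweep
begin

text \<open>With no free coordinates \<open>l1_dist\<close> is \<open>\<bar>a - b\<bar>\<close>, so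
  the weight is an integer and is computed exactly. Each partial sum is at most
  \<open>2 * den 0\<close> because \<open>\<bar>A l - B l\<bar> \<le> A l + B l\<close>.\<close>

lemma wp_accumulate:
  assumes inv: "inv 0 s" and s: "s 9 0 = - s 11 0" "s 10 0 = s 11 0 + 1"
    and R: "\<And>s' w. s' 1 0 = w \<Longrightarrow> s' 2 0 = den 0 \<Longrightarrow> w \<le> 2 * den 0 \<Longrightarrow>
      real_of_int w = weight 0 (s 4) (s 5) \<Longrightarrow> R s'"
  shows "wp Bmax Zmax accumulate R s"
proof -
  define L A B where "L = s 11 0" and "A = s 4" and "B = s 5"
  have good: "good 0 A B" and L: "0 \<le> L" "L \<le> max_bucket"
    and supp: "\<And>l. L < \<bar>l\<bar> \<Longrightarrow> A l = 0 \<and> B l = 0"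
    using inv by (auto simp: inv_def scalars_def L_def A_def B_def)
  have s12: "s 1 0 = 0" "s 2 0 = den 0"
    using inv by (auto simp: inv_def scalars_def)
  have bound: "(\<Sum>l\<in>I. \<bar>A l - B l\<bar>) \<le> 2 * den 0" if "I \<subseteq> {-max_bucket..max_bucket}" for I
  proof -
    have "(\<Sum>l\<in>I. \<bar>A l - B l\<bar>) \<le> (\<Sum>l=-max_bucket..max_bucket. \<bar>A l - B l\<bar>)"
      using that by (intro sum_mono2) auto
    also have "\<dots> \<le> (\<Sum>l=-max_bucket..max_bucket. A l + B l)"
    proof (rule sum_mono)
      fix l
      have "0 \<le> A l" "0 \<le> B l" using good by (auto simp: good_def)
      then show "\<bar>A l - B l\<bar> \<le> A l + B l" by simp
    qed
    also have "\<dots> = 2 * den 0"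
      using good by (simp add: sum.distrib good_def)
    finally show ?thesis .
  qed
  have sub: "{-L..<L + 1} \<subseteq> {-max_bucket..max_bucket}"
    using L by auto
  have full: "(\<Sum>l\<in>{-L..<L + 1}. \<bar>A l - B l\<bar>) = (\<Sum>l=-max_bucket..max_bucket. \<bar>A l - B l\<bar>)"
    using L supp by (intro sum.mono_neutral_left) auto
  have weight: "weight 0 A B = real_of_int (\<Sum>l\<in>{-L..<L + 1}. \<bar>A l - B l\<bar>)"
    unfolding full by (simp add: weight_def)
  show ?thesis
    unfolding accumulate_def
  proof (rule wp_For[where h = "L + 1" and
        I = "\<lambda>j s'. s' 2 0 = den 0 \<and> s' 4 = A \<and> s' 5 = B \<and> s' 1 0 = (\<Sum>l\<in>{-L..<j}. \<bar>A l - B l\<bar>)"])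
    show "s 2 0 = den 0 \<and> s 4 = A \<and> s 5 = B \<and> s 1 0 = (\<Sum>l\<in>{-L..<s 9 0}. \<bar>A l - B l\<bar>)"
      using s s12 by (simp add: L_def A_def B_def)
    show "nat (L + 1 - s 9 0) \<le> Bmax"
      using L s unfolding max_bucket_def Bmax_def of_nat_le_iff[symmetric, where 'a = int]
      by (simp add: nat_le_iff L_def)
    show "\<bar>s 9 0\<bar> \<le> Zmax" "\<bar>L + 1\<bar> \<le> Zmax" "s 9 0 \<le> L + 1" "s 10 0 = L + 1"
      using L s max_bucket_less_Zmax by (simp_all add: L_def)
    show "R s'" if "s' 2 0 = den 0 \<and> s' 4 = A \<and> s' 5 = B \<and>
        s' 1 0 = (\<Sum>l\<in>{-L..<L + 1}. \<bar>A l - B l\<bar>)" for s'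
      using that weight bound[OF sub]
      by (intro R[OF refl]) (auto simp: A_def B_def)
  next
    fix j and s' :: store
    assume j: "s 9 0 \<le> j" "j < L + 1" and s': "s' 9 0 = j" "s' 10 0 = L + 1"
      and I: "s' 2 0 = den 0 \<and> s' 4 = A \<and> s' 5 = B \<and> s' 1 0 = (\<Sum>l\<in>{-L..<j}. \<bar>A l - B l\<bar>)"
    have "{-L..<j + 1} = insert j {-L..<j}"
      using j s by (auto simp: L_def)
    then have step: "(\<Sum>l\<in>{-L..<j + 1}. \<bar>A l - B l\<bar>) = (\<Sum>l\<in>{-L..<j}. \<bar>A l - B l\<bar>) + \<bar>A j - B j\<bar>"
      by simp
    have "\<bar>\<Sum>l\<in>{-L..<j + 1}. \<bar>A l - B l\<bar>\<bar> \<le> Zmax"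
    proof -
      have "{-L..<j + 1} \<subseteq> {-max_bucket..max_bucket}"
        using L j by auto
      from bound[OF this] show ?thesis
        using den_le[of 0] two_power_le_Zmax by (simp add: sum_nonneg)
    qed
    moreover have "(A j - B j) * ((if B j < A j then 1 else 0) - (if A j < B j then 1 else 0)) = \<bar>A j - B j\<bar>"
      by simp
    ultimately show "wp Bmax Zmax (Assign 1 (Op Add (Var 1)
     (Op Mul (Op Sub (Read 4 (Var 9)) (Read 5 (Var 9)))
       (Op Sub (Op Less (Read 5 (Var 9)) (Read 4 (Var 9))) (Op Less (Read 4 (Var 9)) (Read 5 (Var 9)))))))
      (\<lambda>s''. s'' 9 0 = j \<and> s'' 10 0 = L + 1 \<and> (put s'' 9 0 (j + 1)) 2 0 = den 0 \<and>
         (put s'' 9 0 (j + 1)) 4 = A \<and> (put s'' 9 0 (j + 1)) 5 = B \<and>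
         (put s'' 9 0 (j + 1)) 1 0 = (\<Sum>l\<in>{-L..<j + 1}. \<bar>A l - B l\<bar>)) s'"
      using s' I step by (intro wp_Write) (simp_all add: put_apply)
  qed simp
qed

lemma wp_algorithm:
  assumes inp: "holds_input s" and M': "int M = int n * s 0 2 div s 0 1 + 1"
    and z: "\<And>x i. x \<noteq> 0 \<Longrightarrow> s x i = 0"
  shows "wp Bmax Zmax algorithm
    (\<lambda>s'. (1 - 1 / M) ^ n * (l1_dist P Q n 1 1 / 2) \<le> answer s' \<and> answer s' \<le> l1_dist P Q n 1 1 / 2) s"
    (is "wp _ _ _ ?R s")
proof -
  have "n \<le> S" by (rule S(2))
  then have "int n \<le> 2 ^ S"
    using of_nat_less_two_power[of S, where 'a = int] by linarith
  then have bd: "int M \<le> Zmax" "1 \<le> Zmax" "int n \<le> Zmax"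
    using two_power_le_Zmax max_bucket_less_Zmax max_bucket_pos M_less_max_bucket
    unfolding power_Suc by linarith+
  have d2: "2 * den 0 \<le> Zmax" "0 < den 0"
    using den_le[of 0] two_power_le_Zmax den_pos by auto
  have sn: "s 0 0 = int n"
    using inp by (simp add: holds_input_def)
  let ?s = "put (put (put (put (put s 3 0 (int M)) 2 0 1) 4 0 1) 5 0 1) 8 0 (int n)"
  have unit: "(s x)(0 := 1) = (\<lambda>l. if l = 0 then 1 else 0)" if "x \<noteq> 0" for x
    using z[OF that] by (simp add: fun_eq_iff)
  have inv: "inv n ?s"
    using inp z max_bucket_pos good_init
    by (simp add: inv_def scalars_def holds_input_def put_apply den_n unit fun_eq_iff)
  show ?thesis
    unfolding algorithm_def
  proof (intro wp_block_Cons wp_Write, goal_cases)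
    case 6
    have "wp Bmax Zmax (While (Var 8) sweep_round) (wp Bmax Zmax (block
        [Assign 9 (Op Sub (Const 0) (Var 11)), Assign 10 (Op Add (Var 11) (Const 1)), accumulate,
         Assign 2 (Op Mul (Const 2) (Var 2))]) ?R) ?s"
    proof (rule wp_While[where I = "\<lambda>s. \<exists>m. inv m s" and \<mu> = "\<lambda>s. nat (s 8 0)"])
      show "\<exists>m. inv m ?s" using inv by blast
      show "nat (?s 8 0) \<le> Bmax" by (simp add: put_apply Bmax_def)
    next
      fix s1 assume "\<exists>m. inv m s1" and ne: "eval_expr s1 (Var 8) \<noteq> 0"
      then obtain m where inv: "inv m s1" by blast
      then have "s1 8 0 = int m" by (simp add: inv_def scalars_def)
      with ne obtain m' where m: "m = Suc m'"
        by (cases m) auto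
      show "wp Bmax Zmax sweep_round (\<lambda>s'. (\<exists>m. inv m s') \<and> nat (s' 8 0) < nat (s1 8 0)) s1"
        using wp_round[OF inv[unfolded m]]
      proof (rule wp_mono)
        fix s2 assume "inv m' s2"
        moreover from this have "s2 8 0 = int m'" by (simp add: inv_def scalars_def)
        ultimately show "(\<exists>m. inv m s2) \<and> nat (s2 8 0) < nat (s1 8 0)"
          using \<open>s1 8 0 = int m\<close> m by auto
      qed
    next
      fix s1 assume "\<exists>m. inv m s1" and ne: "eval_expr s1 (Var 8) = 0"
      then obtain m where inv: "inv m s1" by blast
      then have "s1 8 0 = int m" by (simp add: inv_def scalars_def)
      with ne inv have inv0: "inv 0 s1" by simp
      let ?s2 = "put (put s1 9 0 (- s1 11 0)) 10 0 (s1 11 0 + 1)"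
      have inv2: "inv 0 ?s2"
        using inv0 by (simp add: inv_def scalars_put) (simp add: put_apply)
      have L: "0 \<le> s1 11 0" "s1 11 0 \<le> max_bucket"
        using inv0 by (auto simp: inv_def scalars_def)
      have good: "good 0 (?s2 4) (?s2 5)"
        using inv2 by (simp add: inv_def)
      have total: "wp Bmax Zmax accumulate (wp Bmax Zmax (block [Assign 2 (Op Mul (Const 2) (Var 2))]) ?R) ?s2"
      proof (rule wp_accumulate[OF inv2], goal_cases)
        case (3 s' w)
        let ?s3 = "put s' 2 0 (2 * den 0)"
        have "answer ?s3 = w / (2 * den 0)"
          using 3 by (simp add: answer_def put_apply)
        then have ans: "answer ?s3 = weight 0 (?s2 4) (?s2 5) / den 0 / 2"
          using 3 by simp
        have "(1 - 1 / M) ^ n * l1_dist P Q n 1 1 \<le> weight 0 (?s2 4) (?s2 5) / den 0"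
          "weight 0 (?s2 4) (?s2 5) / den 0 \<le> l1_dist P Q n 1 1"
          using good d2(2) by (simp_all add: good_def pos_le_divide_eq pos_divide_le_eq mult.assoc)
        then have "?R ?s3"
          unfolding ans by simp
        then show ?case
          using 3 d2 by (intro wp_block_Cons wp_Write wp_block_Nil) auto
      qed (simp_all add: put_apply)
      show "wp Bmax Zmax (block
        [Assign 9 (Op Sub (Const 0) (Var 11)), Assign 10 (Op Add (Var 11) (Const 1)), accumulate,
         Assign 2 (Op Mul (Const 2) (Var 2))]) ?R s1"
      proof (intro wp_block_Cons wp_Write, goal_cases)
        case 3
        show ?case
          using total by (simp add: put_apply)
      qed (use L max_bucket_less_Zmax in \<open>simp_all add: put_apply\<close>)
    qed
    then show ?case
      using M' sn by (simp add: put_apply)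
  qed (use M' sn bd in \<open>simp_all add: put_apply\<close>)
qed

end

subsection \<open>The encoding of the input\<close>

lemma encode_rats_simps: "encode_rats [] = []"
  "encode_rats (r # rs) = fst (quotient_of r) # snd (quotient_of r) # encode_rats rs"
  by (simp_all add: encode_rats_def)

lemma encode_rats_append: "encode_rats (rs @ rs') = encode_rats rs @ encode_rats rs'"
  by (simp add: encode_rats_def)

lemma length_encode_rats: "length (encode_rats rs) = 2 * length rs"
  by (induction rs) (simp_all add: encode_rats_simps)

lemma nth_encode_rats:
  "i < length rs \<Longrightarrow> encode_rats rs ! (2 * i) = fst (quotient_of (rs ! i))"
  "i < length rs \<Longrightarrow> encode_rats rs ! Suc (2 * i) = snd (quotient_of (rs ! i))"
  by (induction rs arbitrary: i) (auto simp: encode_rats_simps nth_Cons' less_Suc_eq_0_disj)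

lemma input_size_Cons: "input_size (z # zs) = bit_length z + input_size zs"
  and input_size_append: "input_size (zs @ zs') = input_size zs + input_size zs'"
  and input_size_Nil: "input_size [] = 0"
  by (simp_all add: input_size_def)

lemma bit_length_nth_le: "i < length zs \<Longrightarrow> bit_length (zs ! i) \<le> input_size zs"
  unfolding input_size_def by (rule member_le_sum_list) simp_all

text \<open>Lengths add where denominators multiply: this is why the common denominator has no more
  bits than the input.\<close>

lemma prod_le_input_size:
  assumes "\<And>i. i < length rs \<Longrightarrow> d i = snd (quotient_of (rs ! i))"
  shows "(\<Prod>i<length rs. d i) \<le> 2 ^ input_size (encode_rats rs)"
  using assms
proof (induction rs arbitrary: d)
  case (Cons r rs)
  have pos: "0 \<le> (\<Prod>i<length rs. d (Suc i))"
  proof (rule prod_nonneg)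
    fix i assume "i \<in> {..<length rs}"
    then show "0 \<le> d (Suc i)"
      using Cons.prems[of "Suc i"] quotient_of_denom_pos'[of "rs ! i"] by simp
  qed
  have "(\<Prod>i<length (r # rs). d i) = d 0 * (\<Prod>i<length rs. d (Suc i))"
    by (simp add: prod.lessThan_Suc_shift del: prod.lessThan_Suc)
  also have "\<dots> \<le> 2 ^ bit_length (d 0) * 2 ^ input_size (encode_rats rs)"
    using abs_le_two_power_bit_length[of "d 0"] pos
    by (intro mult_mono Cons.IH) (use Cons.prems[of "Suc _"] in auto)
  also have "\<dots> \<le> 2 ^ input_size (encode_rats (r # rs))"
    unfolding power_add[symmetric] using Cons.prems[of 0]
    by (intro power_increasing) (simp_all add: encode_rats_simps input_size_Cons)
  finally show ?case .
qed (simp add: encode_rats_simps input_size_Nil)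

lemma length_le_input_size: "length zs \<le> input_size zs"
proof (induction zs)
  case (Cons z zs)
  then show ?case
    using bit_length_pos[of z] by (simp add: input_size_Cons)
qed (simp add: input_size_Nil)

lemma quotient_of_unit_interval:
  assumes "r \<in> {0..1}"
  shows "0 \<le> fst (quotient_of r)" "fst (quotient_of r) \<le> snd (quotient_of r)"
proof -
  obtain a b where ab: "quotient_of r = (a, b)" by force
  have b: "0 < b" using quotient_of_denom_pos[OF ab] .
  have "r = of_int a / of_int b" using quotient_of_div[OF ab] .
  with assms b have "0 \<le> (of_int a :: rat)" "(of_int a :: rat) \<le> of_int b"
    by (auto simp: zero_le_divide_iff pos_divide_le_eq not_less)
  then show "0 \<le> fst (quotient_of r)" "fst (quotient_of r) \<le> snd (quotient_of r)"
    by (simp_all add: ab)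
qed

lemma real_of_rat_quotient: "real_of_rat r = fst (quotient_of r) / snd (quotient_of r)"
proof -
  obtain a b where ab: "quotient_of r = (a, b)" by force
  show ?thesis
    by (subst quotient_of_div[OF ab]) (simp add: ab of_rat_divide)
qed

subsection \<open>The running time\<close>

text \<open>The estimate \<open>M + 1 \<le> 2 ^ M\<close> is crude, but \<open>M\<close> itself is
  polynomial in the parameters, so the length stays polynomial.\<close>

lemma (in sweep) bit_length_Zmax: "bit_length Zmax \<le> Suc (Suc (Suc S) + M * (M * Suc S))"
proof -
  have "int M + 1 \<le> 2 ^ M"
    using of_nat_less_two_power[of M, where 'a = int] by linarith
  then have "(int M + 1) ^ (M * Suc S) \<le> (2 ^ M) ^ (M * Suc S)"
    by (rule power_mono) simp
  then have "Zmax \<le> 2 ^ Suc S * 2 ^ (M * (M * Suc S))"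
    unfolding Zmax_def power_mult[symmetric] by (rule mult_left_mono) simp
  also have "\<dots> < 2 ^ (Suc (Suc S) + M * (M * Suc S))"
    by (simp add: power_add)
  finally show ?thesis
    using two_power_le_Zmax zero_le_power[of "2::int" "Suc S"]
    by (subst bit_length_le_Suc_iff) linarith
qed

text \<open>\<open>x\<close> stands for the input size plus \<open>1 / \<epsilon>\<close> plus
  \<open>1 / \<delta>\<close>. The exponent combines \<open>Suc Bmax \<le> 13 * x ^ 3\<close>,
  raised to the degree \<open>d\<close> of the program, with a bit length of at most
  \<open>13 * x ^ 5\<close>.\<close>

lemma polynomial_time_bound:
  obtains C d where "\<And>n S M pn pd qn qd x. sweep n S M pn pd qn qd \<Longrightarrow> 1 \<le> x \<Longrightarrow>
    real S \<le> x \<Longrightarrow> real M \<le> 2 * x\<^sup>2 \<Longrightarrow>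
    real (time_bound (sweep.Bmax n S M) algorithm * bit_length (sweep.Zmax S M)) \<le> real C * x ^ d"
proof -
  obtain K d where K: "\<And>B. time_bound B algorithm \<le> K * Suc B ^ d"
    using time_bound_poly by blast
  have "real (time_bound (sweep.Bmax n S M) algorithm * bit_length (sweep.Zmax S M))
      \<le> real (K * 13 ^ d * 13) * x ^ (3 * d + 5)"
    if sw: "sweep n S M pn pd qn qd" and x: "1 \<le> x" and Sx: "real S \<le> x" and Mx: "real M \<le> 2 * x\<^sup>2"
    for n S M pn pd qn qd x
  proof -
    interpret sweep n S M pn pd qn qd by (rule sw)
    have pw: "x ^ a \<le> x ^ b" if "a \<le> b" for a b
      using that x by (rule power_increasing)
    have "real n \<le> real S" using S(2) by (simp only: of_nat_le_iff)
    with Sx have n: "real n \<le> x" by linarith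
    have S1: "real (Suc S) \<le> 2 * x" using Sx x by simp
    have MS: "real (M * Suc S) \<le> 4 * x ^ 3"
    proof -
      have "real M * real (Suc S) \<le> (2 * x\<^sup>2) * (2 * x)"
        using Mx S1 x by (intro mult_mono) auto
      also have "(2 * x\<^sup>2) * (2 * x) = 4 * x ^ 3"
        by (simp add: power2_eq_square power3_eq_cube)
      finally show ?thesis by (simp only: of_nat_mult)
    qed
    have MMS: "real (M * (M * Suc S)) \<le> 8 * x ^ 5"
    proof -
      have "real M * real (M * Suc S) \<le> (2 * x\<^sup>2) * (4 * x ^ 3)"
        using Mx MS x by (intro mult_mono) auto
      also have "(2 * x\<^sup>2) * (4 * x ^ 3) = 8 * x ^ 5"
        by (simp flip: power_add)
      finally show ?thesis by (simp only: of_nat_mult)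
    qed
    have "real (Suc Bmax) = 2 * real (M * Suc S) + 4 + real n"
      by (simp add: Bmax_def)
    also have "\<dots> \<le> 13 * x ^ 3"
      using MS n pw[of 1 3] pw[of 0 3] by simp
    finally have "real (Suc Bmax) ^ d \<le> (13 * x ^ 3) ^ d"
      by (rule power_mono) simp
    then have Bd: "real (Suc Bmax ^ d) \<le> 13 ^ d * x ^ (3 * d)"
      by (simp add: power_mult_distrib power_mult)
    have "real (bit_length Zmax) \<le> real (Suc (Suc (Suc S) + M * (M * Suc S)))"
      using bit_length_Zmax by (simp only: of_nat_le_iff)
    also have "\<dots> \<le> 13 * x ^ 5"
      using MMS S1 pw[of 1 5] pw[of 0 5] by simp
    finally have Zb: "real (bit_length Zmax) \<le> 13 * x ^ 5" .
    have "real (time_bound Bmax algorithm) \<le> real K * real (Suc Bmax ^ d)"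
      using K[of Bmax] by (simp only: flip: of_nat_mult of_nat_le_iff[where 'a = real])
    also have "\<dots> \<le> real K * (13 ^ d * x ^ (3 * d))"
      using Bd by (rule mult_left_mono) simp
    finally have "real (time_bound Bmax algorithm) * real (bit_length Zmax)
        \<le> (real K * (13 ^ d * x ^ (3 * d))) * (13 * x ^ 5)"
      using Zb x by (intro mult_mono) auto
    then show ?thesis
      by (simp add: power_add mult_ac)
  qed
  then show ?thesis by (rule that)
qed

theorem theorem3:
  fixes k :: nat
  shows "\<exists>(A :: com) (C :: nat) (d :: nat).
    \<forall>(\<epsilon> :: rat) (\<delta> :: rat) (p :: rat list) (q :: rat list).
      0 < \<epsilon> \<longrightarrow> 0 < \<delta> \<longrightarrow> length p = length q \<longrightarrow>
      set p \<subseteq> {0..1} \<longrightarrow> set q \<subseteq> {0..1} \<longrightarrow> card (set q) \<le> k \<longrightarrow>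
      (\<exists>D. exec A (initial_store (encode_input \<epsilon> \<delta> p q)) D \<and>
        (\<forall>(s, t) \<in> set_pmf D.
           real t \<le> real C *
             (real (input_size (encode_input \<epsilon> \<delta> p q)) + 1 / of_rat \<epsilon> + 1 / of_rat \<delta>) ^ d) \<and>
        measure_pmf.prob D
          {(s, t).
             (1 - of_rat \<epsilon>) * tv_dist (cube (length p)) (prod_bern p) (prod_bern q) \<le> answer s \<and>
             answer s \<le> (1 + of_rat \<epsilon>) * tv_dist (cube (length p)) (prod_bern p) (prod_bern q)}
          \<ge> 1 - of_rat \<delta>)"
proof -
  obtain C d where time: "\<And>n S M pn pd qn qd x. sweep n S M pn pd qn qd \<Longrightarrow> 1 \<le> x \<Longrightarrow>
    real S \<le> x \<Longrightarrow> real M \<le> 2 * x\<^sup>2 \<Longrightarrow>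
    real (time_bound (sweep.Bmax n S M) algorithm * bit_length (sweep.Zmax S M)) \<le> real C * x ^ d"
    using polynomial_time_bound by blast
  have "\<exists>D. exec algorithm (initial_store (encode_input \<epsilon> \<delta> p q)) D \<and>
        (\<forall>(s, t) \<in> set_pmf D.
           real t \<le> real C *
             (real (input_size (encode_input \<epsilon> \<delta> p q)) + 1 / of_rat \<epsilon> + 1 / of_rat \<delta>) ^ d) \<and>
        measure_pmf.prob D
          {(s, t).
             (1 - of_rat \<epsilon>) * tv_dist (cube (length p)) (prod_bern p) (prod_bern q) \<le> answer s \<and>
             answer s \<le> (1 + of_rat \<epsilon>) * tv_dist (cube (length p)) (prod_bern p) (prod_bern q)}
          \<ge> 1 - of_rat \<delta>"
    if eps: "0 < \<epsilon>" and del: "0 < \<delta>" and len: "length p = length q"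
      and p: "set p \<subseteq> {0..1}" and q: "set q \<subseteq> {0..1}"
    for \<epsilon> \<delta> :: rat and p q
  proof -
    define n where "n = length p"
    define zs where "zs = encode_input \<epsilon> \<delta> p q"
    define S where "S = input_size zs"
    obtain en ed where e: "quotient_of \<epsilon> = (en, ed)" by force
    have ed: "0 < ed" using quotient_of_denom_pos[OF e] .
    have eps_eq: "real_of_rat \<epsilon> = en / ed"
      using real_of_rat_quotient[of \<epsilon>] e by simp
    have epsr: "0 < real_of_rat \<epsilon>" and delr: "0 < real_of_rat \<delta>"
      using eps del by simp_all
    have en: "0 < en"
      using epsr ed unfolding eps_eq by (simp add: zero_less_divide_iff)
    define M where "M = nat (int n * ed div en + 1)"
    have M_eq: "int M = int n * ed div en + 1"
      using en ed by (simp add: M_def pos_imp_zdiv_nonneg_iff add_nonneg_nonneg)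
    have M_pos: "0 < M"
    proof -
      have "0 \<le> int n * ed div en"
        using en ed by (simp add: pos_imp_zdiv_nonneg_iff)
      then show ?thesis using M_eq by linarith
    qed
    \<comment> \<open>Integer division of the cross product is the floor of
      \<open>n / \<epsilon>\<close>; both estimates on \<open>M\<close> follow from this.\<close>
    have M_floor: "int M = \<lfloor>real n / real_of_rat \<epsilon>\<rfloor> + 1"
      unfolding M_eq eps_eq using floor_divide_of_int_eq[of "int n * ed" en, where 'a = real] by simp
    have M_ge: "real n / real_of_rat \<epsilon> \<le> real M" and M_le: "real M \<le> real n / real_of_rat \<epsilon> + 1"
      using M_floor by linarith+
    \<comment> \<open>Beyond \<open>n\<close> the fraction 0/1 is used, so that the locale
      conditions hold at every index.\<close>
    define pn where "pn i = (if i < n then fst (quotient_of (p ! i)) else 0)" for i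
    define pd where "pd i = (if i < n then snd (quotient_of (p ! i)) else 1)" for i
    define qn where "qn i = (if i < n then fst (quotient_of (q ! i)) else 0)" for i
    define qd where "qd i = (if i < n then snd (quotient_of (q ! i)) else 1)" for i
    have zs: "zs = int n # fst (quotient_of \<epsilon>) # snd (quotient_of \<epsilon>) #
        fst (quotient_of \<delta>) # snd (quotient_of \<delta>) # encode_rats p @ encode_rats q"
      by (simp add: zs_def encode_input_def encode_rats_simps encode_rats_append n_def)
    have size: "input_size (encode_rats p) + input_size (encode_rats q) \<le> S"
      by (simp add: S_def zs input_size_Cons input_size_append)
    have "length zs \<le> S"
      unfolding S_def by (rule length_le_input_size)
    then have nS: "n \<le> S" "1 \<le> S"
      by (simp_all add: zs length_encode_rats n_def)
    interpret sweep n S M pn pd qn qd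
    proof
      fix i
      have pi: "p ! i \<in> {0..1}" if "i < n"
        using p nth_mem[of i p] that unfolding n_def by blast
      have qi: "q ! i \<in> {0..1}" if "i < n"
        using q nth_mem[of i q] that len unfolding n_def by (metis subsetD)
      show "0 \<le> pn i" "pn i \<le> pd i"
        using quotient_of_unit_interval[OF pi] by (simp_all add: pn_def pd_def)
      show "0 \<le> qn i" "qn i \<le> qd i"
        using quotient_of_unit_interval[OF qi] by (simp_all add: qn_def qd_def)
      show "0 < pd i" "0 < qd i"
        by (simp_all add: pd_def qd_def quotient_of_denom_pos')
    next
      have pr: "(\<Prod>i<n. pd i) \<le> 2 ^ input_size (encode_rats p)" "(\<Prod>i<n. qd i) \<le> 2 ^ input_size (encode_rats q)"
        using prod_le_input_size[of p pd] prod_le_input_size[of q qd] len by (simp_all add: n_def pd_def qd_def)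
      have "(\<Prod>i<n. pd i * qd i) = (\<Prod>i<n. pd i) * (\<Prod>i<n. qd i)"
        by (rule prod.distrib)
      also have "\<dots> \<le> 2 ^ input_size (encode_rats p) * 2 ^ input_size (encode_rats q)"
        using pr by (intro mult_mono prod_nonneg)
          (auto simp: qd_def quotient_of_denom_pos' less_imp_le)
      also have "\<dots> \<le> 2 ^ S"
        unfolding power_add[symmetric] using size by (intro power_increasing) simp_all
      finally show "(\<Prod>i<n. pd i * qd i) \<le> 2 ^ S" .
    qed (fact M_pos nS)+
    define s where "s = initial_store zs"
    have s0: "s 0 (int i) = zs ! i" if "i < length zs" for i
      using that by (simp add: s_def initial_store_def)
    have len_zs: "length zs = 5 + 2 * n + 2 * n"
      using len by (simp add: zs length_encode_rats n_def)
    have "holds_input s"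
      unfolding holds_input_def
    proof (intro conjI allI impI)
      show "s 0 0 = int n"
        using s0[of 0] by (simp add: zs)
      fix i assume i: "i < n"
      have "zs ! (5 + 2 * i) = pn i" "zs ! (6 + 2 * i) = pd i"
        "zs ! (5 + 2 * n + 2 * i) = qn i" "zs ! (6 + 2 * n + 2 * i) = qd i"
        using i len nth_encode_rats[of i p] nth_encode_rats[of i q]
        by (simp_all add: zs nth_append length_encode_rats n_def pn_def pd_def qn_def qd_def
            numeral_eq_Suc)
      then show "s 0 (5 + 2 * int i) = pn i" "s 0 (6 + 2 * int i) = pd i"
        "s 0 (5 + 2 * int n + 2 * int i) = qn i" "s 0 (6 + 2 * int n + 2 * int i) = qd i"
        using s0[of "5 + 2 * i"] s0[of "6 + 2 * i"] s0[of "5 + 2 * n + 2 * i"] s0[of "6 + 2 * n + 2 * i"]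
          i len_zs by simp_all
    qed
    moreover have "int M = int n * s 0 2 div s 0 1 + 1"
      using s0[of 1] s0[of 2] len_zs by (simp add: zs e M_eq)
    moreover have "s x i = 0" if "x \<noteq> 0" for x i
      using that by (simp add: s_def initial_store_def)
    ultimately have wp: "wp Bmax Zmax algorithm
      (\<lambda>s'. (1 - 1 / M) ^ n * (l1_dist P Q n 1 1 / 2) \<le> answer s' \<and> answer s' \<le> l1_dist P Q n 1 1 / 2) s"
      by (rule wp_algorithm)
    have "bounded_store Zmax s"
      unfolding bounded_store_def
    proof (intro allI)
      fix x i
      have "\<bar>zs ! j\<bar> \<le> Zmax" if "j < length zs" for j
      proof -
        have "(2::int) ^ bit_length (zs ! j) \<le> 2 ^ Suc S"
          using bit_length_nth_le[OF that] by (intro power_increasing) (simp_all add: S_def)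
        then show ?thesis
          using abs_le_two_power_bit_length[of "zs ! j"] two_power_le_Zmax by linarith
      qed
      moreover have "0 \<le> Zmax"
        using two_power_le_Zmax zero_le_power[of "2::int" "Suc S"] by linarith
      ultimately show "\<bar>s x i\<bar> \<le> Zmax"
        by (auto simp: s_def initial_store_def)
    qed
    with wp obtain s' t where ex: "exec algorithm s (return_pmf (s', t))"
      and t: "t \<le> time_bound Bmax algorithm * bit_length Zmax"
      and ans: "(1 - 1 / M) ^ n * (l1_dist P Q n 1 1 / 2) \<le> answer s'" "answer s' \<le> l1_dist P Q n 1 1 / 2"
      unfolding wp_def by blast
    define x where "x = real S + 1 / real_of_rat \<epsilon> + 1 / real_of_rat \<delta>"
    have x: "1 \<le> x" "real S \<le> x"
      using nS epsr delr by (simp_all add: x_def add_nonneg_nonneg add_increasing2)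
    \<comment> \<open>Both \<open>n\<close> and \<open>1 / \<epsilon>\<close> are at most
      \<open>x\<close>, and the added 1 is at most \<open>x\<^sup>2\<close> since
      \<open>x \<ge> 1\<close>.\<close>
    have Mx: "real M \<le> 2 * x\<^sup>2"
    proof -
      have "real n / real_of_rat \<epsilon> = real n * (1 / real_of_rat \<epsilon>)"
        by simp
      also have "\<dots> \<le> x * x"
      proof (rule mult_mono)
        have "real n \<le> real S" using nS by simp
        then show "real n \<le> x" using x by linarith
      qed (use epsr delr x in \<open>simp_all add: x_def\<close>)
      finally show ?thesis
        using M_le one_le_power[OF x(1), of 2] by (simp add: power2_eq_square)
    qed
    have "real t \<le> real (time_bound Bmax algorithm * bit_length Zmax)"
      using t by (simp only: of_nat_le_iff)
    also have "\<dots> \<le> real C * x ^ d"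
      by (rule time[OF sweep_axioms x Mx])
    finally have tx: "real t \<le> real C * x ^ d" .
    let ?tv = "tv_dist (cube (length p)) (prod_bern p) (prod_bern q)"
    have tv: "?tv = l1_dist P Q n 1 1 / 2"
      unfolding n_def using len \<open>set p \<subseteq> {0..1}\<close> \<open>set q \<subseteq> {0..1}\<close>
      by (intro tv_dist_prod_bern)
        (simp_all add: P_def Q_def pn_def pd_def qn_def qd_def n_def real_of_rat_quotient)
    have tv_nonneg: "0 \<le> ?tv"
      unfolding tv by (simp add: l1_dist_nonneg)
    \<comment> \<open>\<open>M \<ge> n / \<epsilon>\<close> makes the accumulated loss
      \<open>n / M\<close> at most \<epsilon>; Bernoulli's inequality then compares it with the
      product over all rounds.\<close>
    have "1 - real_of_rat \<epsilon> \<le> 1 - n / real M"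
      using M_ge epsr M_pos by (simp add: field_simps)
    also have "\<dots> \<le> (1 - 1 / M) ^ n"
      using Bernoulli_inequality[of "- 1 / M" n] M_pos by simp
    finally have "(1 - real_of_rat \<epsilon>) * ?tv \<le> (1 - 1 / M) ^ n * ?tv"
      using tv_nonneg by (rule mult_right_mono)
    then have low: "(1 - real_of_rat \<epsilon>) * ?tv \<le> answer s'"
      by (rule order_trans) (use ans(1) in \<open>simp only: tv\<close>)
    have "answer s' \<le> 1 * ?tv"
      using ans(2) by (simp only: tv mult_1)
    also have "\<dots> \<le> (1 + real_of_rat \<epsilon>) * ?tv"
      using epsr tv_nonneg by (intro mult_right_mono) simp_all
    finally have up: "answer s' \<le> (1 + real_of_rat \<epsilon>) * ?tv" .
    show ?thesis
    \<comment> \<open>The run is deterministic, so the accuracy event has probability 1, which is at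
      least \<open>1 - \<delta>\<close>.\<close>
    proof (intro exI[of _ "return_pmf (s', t)"] conjI)
      show "exec algorithm (initial_store (encode_input \<epsilon> \<delta> p q)) (return_pmf (s', t))"
        using ex by (simp add: s_def zs_def)
    qed (use tx low up delr in \<open>simp_all add: x_def S_def zs_def measure_return_pmf indicator_def\<close>)
  qed
  then show ?thesis by blast
qed

end
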